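(* Fix an integer $k \ge 2$. For a positive integer $N$, let $E_k(N)$ be the number of $k$-tuples $(n_1,\ldots,n_k)\in[1,N]^k$ of integers with $n_1<n_2<\cdots<n_k$ such that the polynomial $F(x) = 1 + x^{n_1}+\cdots+x^{n_k}$, removed of its cyclotomic factors, is reducible over $\mathbb{Q}$. Then $E_k(N) = o(N^k)$ as $N\to\infty$. In other words, for almost all choices of positive integers $n_1<\cdots<n_k$, the polynomial $F(x)$ removed of its cyclotomic factors is irreducible.
   Context: "Removed of its cyclotomic factors" means $F(x)$ divided by the product of all its cyclotomic-polynomial factors (with multiplicity) in $\mathbb{Z}[x]$. *)

theory Defs
  imports "HOL-Analysis.Analysis" "HOL-Computational_Algebra.Polynomial_Factorial"
    "HOL-Library.Landau_Symbols"
begin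

definition cyclotomic_complex :: "nat \<Rightarrow> complex poly" where
  "cyclotomic_complex m =
     (\<Prod>k\<in>{k. k < m \<and> coprime k m}. [:- cis (2 * pi * real k / real m), 1:])"

definition cyclotomic :: "nat \<Rightarrow> int poly" where
  "cyclotomic m = (THE p. map_poly of_int p = cyclotomic_complex m)"

definition noncyclotomic_part :: "int poly \<Rightarrow> int poly" where
  "noncyclotomic_part F = (THE G. \<exists>M :: nat multiset. (\<forall>m\<in>#M. m \<ge> 1) \<and>
       F = (\<Prod>m\<in>#M. cyclotomic m) * G \<and> (\<forall>m\<ge>1. \<not> cyclotomic m dvd G))"

definition reducible_poly :: "'a::field poly \<Rightarrow> bool" where
  "reducible_poly p \<longleftrightarrow> (\<exists>g h. degree g \<ge> 1 \<and> degree h \<ge> 1 \<and> p = g * h)"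

definition F_poly :: "nat list \<Rightarrow> int poly" where
  "F_poly ns = 1 + (\<Sum>i<length ns. monom 1 (ns ! i))"

definition E :: "nat \<Rightarrow> nat \<Rightarrow> nat" where
  "E k N = card {ns :: nat list. length ns = k \<and> sorted_wrt (<) ns \<and> set ns \<subseteq> {1..N} \<and>
       reducible_poly (map_poly (of_int :: int \<Rightarrow> rat) (noncyclotomic_part (F_poly ns)))}"

end

theory Submission
  imports Defs "HOL-Computational_Algebra.Fundamental_Theorem_Algebra"
begin

text \<open>
  Outside $O(N^{k-1})$ tuples, sums of three elements of $S = \{0, n_1, \ldots, n_k\}$ are
  unique up to order. If then $F = A h$ with $h$ and a divisor $g$ of $A$ nonconstant factors of
  the noncyclotomic part, Ljunggren's trick applied to $A h^*$ ($h^*$ is the reciprocal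
  polynomial) gives $A h^* = F$ or $A h^* = F^*$. In either case $F$ and $F^*$ share an irreducible
  factor $q$ without roots of unity among its roots.

  Fix $n_1, \ldots, n_{k-1}$ and put $P = 1 + x^{n_1} + \cdots + x^{n_{k-1}}$. Each such $q$
  divides $P(x) P(1/x) - 1$, up to a power of $x$, and $q$ determines $n_k$. A nonzero polynomial of
  degree at most $2N$ has at most $2N/D$ prime factors of degree at least $D$; the remaining $q$ are
  monic with all roots in $|z| \le 2$, hence finite in number for fixed $D$ (Northcott). So there are $o(N)$
  bad values of $n_k$.
\<close>

section \<open>Integer polynomials and their complex roots\<close>

text \<open>Both definite descriptions in the definitions carry proof obligations.
  \<open>cyclotomic m\<close> denotes something only once the complex product is known to have
  integer coefficients, and \<open>noncyclotomic_part\<close> is well defined through unique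
  factorization in the integer polynomials, with the cyclotomic polynomials among the primes. Hence
  their irreducibility is established first.

  Removing the cyclotomic factors matters in the count: a shared factor \<open>q\<close> fixes the
  last exponent only because z^n = z^m at a root z forces n = m, which fails for roots of unity.

  The degree bound alone, with D = 1, would allow about 2N exponents and save nothing. So D is fixed
  in terms of the required precision before N grows: high-degree factors cost at most 2N/D
  exponents, and the low-degree ones form a finite set that depends on D but not on N. This
  finiteness comes without a rate, so the conclusion is a bare o(N^k).\<close>

abbreviation cpoly :: "int poly \<Rightarrow> complex poly" where
  "cpoly \<equiv> map_poly of_int"

lemma coeff_cpoly [simp]: "coeff (cpoly p) n = of_int (coeff p n)"
  by (simp add: coeff_map_poly)

lemma cpoly_add: "cpoly (p + q) = cpoly p + cpoly q"
  by (intro poly_eqI) simp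

lemma cpoly_diff: "cpoly (p - q) = cpoly p - cpoly q"
  by (intro poly_eqI) simp

lemma cpoly_mult: "cpoly (p * q) = cpoly p * cpoly q"
  by (intro poly_eqI) (simp add: coeff_mult)

lemma cpoly_monom: "cpoly (monom a n) = monom (of_int a) n"
  by (simp add: map_poly_monom)

lemma degree_cpoly [simp]: "degree (cpoly p) = degree p"
  by (simp add: degree_map_poly)

lemma cpoly_eq_0_iff [simp]: "cpoly p = 0 \<longleftrightarrow> p = 0"
  by (simp add: map_poly_eq_0_iff)

lemma cpoly_eq_iff: "cpoly p = cpoly q \<longleftrightarrow> p = q"
  by (auto simp: poly_eq_iff)

lemma cpoly_smult: "cpoly (smult a p) = smult (of_int a) (cpoly p)"
  by (intro poly_eqI) simp

lemma cpoly_dvd: "p dvd q \<Longrightarrow> cpoly p dvd cpoly q"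
  by (auto simp: dvd_def cpoly_mult)

lemma cpoly_root_dvd: "p dvd q \<Longrightarrow> poly (cpoly p) z = 0 \<Longrightarrow> poly (cpoly q) z = 0"
  by (auto simp: dvd_def cpoly_mult)

lemma cpoly_root_degree_pos:
  assumes "poly (cpoly p) z = 0" "p \<noteq> 0"
  shows "degree p > 0"
proof (rule ccontr)
  assume "\<not> degree p > 0"
  then obtain a where "p = [:a:]"
    using degree_eq_zeroE by blast
  with assms show False
    by (simp add: map_poly_pCons)
qed

lemma cpoly_root_exists:
  assumes "degree p > 0"
  obtains z where "poly (cpoly p) z = 0"
  using fundamental_theorem_of_algebra[of "cpoly p"] assms constant_degree[of "cpoly p"] by auto

lemma poly_cpoly_monom_minus_one [simp]: "poly (cpoly (monom 1 n - 1)) z = z ^ n - 1"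
  by (simp add: cpoly_diff cpoly_monom poly_monom)

text \<open>By pseudo-division, a nonzero \<open>f\<close> of least degree vanishing at
  \<open>z\<close> divides, up to a nonzero constant, every polynomial vanishing at
  \<open>z\<close>. Applied to \<open>q\<close> this gives that \<open>q\<close> divides
  \<open>f * u\<close>; were \<open>q\<close> to divide \<open>u\<close>, then \<open>f\<close>
  would be constant. So \<open>q\<close> divides \<open>f\<close>, hence a constant multiple of
  \<open>h\<close>, and \<open>q\<close> has positive degree and cannot divide that
  constant.\<close>

lemma prime_elem_dvd_of_common_root:
  fixes q h :: "int poly"
  assumes q: "prime_elem q" and z: "poly (cpoly q) z = 0" "poly (cpoly h) z = 0"
  shows "q dvd h"
proof -
  have q0: "q \<noteq> 0"
    using q by auto
  obtain f where f: "f \<noteq> 0" "poly (cpoly f) z = 0"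
      and min: "\<And>p. p \<noteq> 0 \<Longrightarrow> poly (cpoly p) z = 0 \<Longrightarrow> degree f \<le> degree p"
    using arg_min_nat_lemma[of "\<lambda>p. p \<noteq> 0 \<and> poly (cpoly p) z = 0" q degree] q0 z(1)
    by blast
  have div: "\<exists>c u. c \<noteq> 0 \<and> smult c p = f * u" if p: "poly (cpoly p) z = 0" for p
  proof -
    obtain u r where ur: "pseudo_divmod p f = (u, r)"
      by force
    define c where "c = lead_coeff f ^ (Suc (degree p) - degree f)"
    have c: "c \<noteq> 0" and eq: "smult c p = f * u + r" and r: "r = 0 \<or> degree r < degree f"
      using pseudo_divmod[OF f(1) ur] f(1) by (simp_all add: c_def)
    have "poly (cpoly r) z = 0"
      using arg_cong[OF eq, of "\<lambda>p. poly (cpoly p) z"] p f(2)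
      by (simp add: cpoly_add cpoly_mult cpoly_smult)
    with r min[of r] have "r = 0"
      by fastforce
    with c eq show ?thesis
      by auto
  qed
  have const: "\<not> q dvd [:c:]" if "c \<noteq> 0" for c
    using dvd_imp_degree_le[of q "[:c:]"] cpoly_root_degree_pos[OF z(1) q0] that by auto
  obtain c u where c: "c \<noteq> 0" "smult c q = f * u"
    using div[OF z(1)] by blast
  obtain d v where d: "d \<noteq> 0" "smult d h = f * v"
    using div[OF z(2)] by blast
  have "q dvd f * u"
    unfolding c(2)[symmetric] by (rule dvd_smult) simp
  with q have "q dvd f \<or> q dvd u"
    by (simp add: prime_elem_dvd_mult_iff)
  moreover have "\<not> q dvd u"
  proof
    assume "q dvd u"
    then obtain w where "u = q * w"
      by blast
    with c(2) have "q * [:c:] = q * (f * w)"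
      by (simp add: mult_ac)
    then have fw: "[:c:] = f * w"
      using q0 by (simp only: mult_cancel_left) simp
    then have "degree f = 0"
      using c(1) by (metis degree_pCons_0 degree_mult_eq add_is_0 mult_zero_right pCons_eq_0_iff)
    with cpoly_root_degree_pos[OF f(2,1)] show False
      by simp
  qed
  ultimately have "q dvd [:d:] * h"
    using d(2) by (simp add: dvd_mult2)
  with q const[OF d(1)] show ?thesis
    by (simp only: prime_elem_dvd_mult_iff) simp
qed

section \<open>Frobenius congruences modulo a prime\<close>

lemma prime_dvd_binomial:
  fixes p k :: nat
  assumes "prime p" "0 < k" "k < p"
  shows "p dvd (p choose k)"
proof -
  have "k * (p choose k) = p * ((p - 1) choose (k - 1))"
    using assms times_binomial_minus1_eq by auto
  then have "p dvd k * (p choose k)"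
    by simp
  moreover have "\<not> p dvd k"
    using assms by (auto dest: dvd_imp_le)
  ultimately show ?thesis
    using assms(1) by (simp add: prime_dvd_mult_iff)
qed

lemma prime_dvd_power_add:
  fixes a b :: "'a :: comm_ring_1"
  assumes "prime p"
  shows "of_nat p dvd (a + b) ^ p - (a ^ p + b ^ p)"
proof -
  have p: "p > 0"
    using assms by (simp add: prime_gt_0_nat)
  have "{..p} = insert 0 (insert p {0<..<p})"
    by auto
  then have "(a + b) ^ p - (a ^ p + b ^ p) =
      (\<Sum>k\<in>{0<..<p}. of_nat (p choose k) * a ^ k * b ^ (p - k))"
    using p by (simp add: binomial_ring)
  also have "of_nat p dvd \<dots>"
  proof (intro dvd_sum dvd_mult2)
    fix k assume "k \<in> {0<..<p}"
    then show "(of_nat p :: 'a) dvd of_nat (p choose k)"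
      using prime_dvd_binomial[OF assms, of k] by (auto simp: dvd_def)
  qed
  finally show ?thesis .
qed

text \<open>Fermat's little theorem. The binomial congruence with second summand 1 makes the claims
  for b and b + 1 equivalent, so induction from 0 reaches the negative integers too.\<close>

lemma prime_dvd_power_minus_self:
  fixes a :: int
  assumes "prime p"
  shows "int p dvd a ^ p - a"
proof -
  have p: "p > 0"
    using assms by (simp add: prime_gt_0_nat)
  have step: "int p dvd (b + 1) ^ p - (b + 1) \<longleftrightarrow> int p dvd b ^ p - b" for b :: int
  proof -
    have "(b + 1) ^ p - (b + 1) = ((b + 1) ^ p - (b ^ p + 1 ^ p)) + (b ^ p - b)"
      by simp
    then show ?thesis
      using prime_dvd_power_add[OF assms, of b 1] by (metis dvd_add_right_iff)
  qed
  show ?thesis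
  proof (induction a rule: int_induct[where k = 0])
    case base
    with p show ?case by (simp add: power_0_left)
  next
    case (step1 i)
    with step[of i] show ?case by simp
  next
    case (step2 i)
    with step[of "i - 1"] show ?case by simp
  qed
qed

text \<open>The Frobenius map modulo p is additive and, by Fermat, fixes the coefficients; the
  induction peels off the constant term, \<open>pCons a f\<close> being a + x f.\<close>

lemma prime_dvd_pcompose_monom:
  fixes f :: "int poly"
  assumes "prime p"
  shows "of_nat p dvd pcompose f (monom 1 p) - f ^ p"
proof (induction f)
  case 0
  have "p > 0"
    using assms by (simp add: prime_gt_0_nat)
  then show ?case by (simp add: power_0_left)
next
  case (pCons a f)
  have split: "pCons a f = [:a:] + monom 1 1 * f"
    by (simp add: monom_altdef)
  have x: "pcompose (monom 1 1) (monom 1 p) = (monom 1 p :: int poly)"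
    by (simp add: monom_Suc pcompose_pCons one_pCons)
  have 1: "of_nat p dvd ([:a:] + monom 1 1 * f) ^ p - ([:a:] ^ p + (monom 1 1 * f) ^ p)"
    by (rule prime_dvd_power_add[OF assms])
  have "[:int p:] dvd [:a ^ p - a:]"
    using prime_dvd_power_minus_self[OF assms, of a] by (simp add: const_poly_dvd_const_poly_iff)
  then have 2: "of_nat p dvd [:a:] ^ p - [:a:]"
    by (simp add: of_nat_poly poly_const_pow)
  have 3: "of_nat p dvd monom 1 p * (pcompose f (monom 1 p) - f ^ p)"
    using pCons by simp
  have "pcompose (pCons a f) (monom 1 p) - pCons a f ^ p =
     monom 1 p * (pcompose f (monom 1 p) - f ^ p) - ([:a:] ^ p - [:a:])
     - (([:a:] + monom 1 1 * f) ^ p - ([:a:] ^ p + (monom 1 1 * f) ^ p))"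
    by (simp only: split pcompose_add pcompose_mult pcompose_const power_mult_distrib x monom_power) (simp add: algebra_simps)
  then show ?case
    using 1 2 3 by (metis dvd_diff)
qed

section \<open>Cyclotomic polynomials\<close>

lemma monic_div_exists:
  fixes f g :: "'a :: idom_divide poly"
  assumes "lead_coeff g = 1"
  shows "\<exists>q r. f = g * q + r \<and> (r = 0 \<or> degree r < degree g)"
proof -
  obtain q r where qr: "pseudo_divmod f g = (q, r)"
    by force
  have "g \<noteq> 0"
    using assms by auto
  from pseudo_divmod[OF this qr] assms show ?thesis
    by auto
qed

lemma dvd_imp_eq_0_of_degree_less:
  fixes f g :: "'a :: idom poly"
  assumes "f dvd g" "g = 0 \<or> degree g < degree f"
  shows "g = 0"
  using assms by (metis dvd_imp_degree_le not_le)

lemma dvd_pcompose_diff: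
  fixes f a b :: "'a :: comm_ring_1 poly"
  shows "a - b dvd pcompose f a - pcompose f b"
proof (induction f)
  case (pCons c f)
  have "pcompose (pCons c f) a - pcompose (pCons c f) b
      = a * (pcompose f a - pcompose f b) + (a - b) * pcompose f b"
    by (simp add: pcompose_pCons algebra_simps)
  with pCons show ?case
    by simp
qed simp

text \<open>
  Landau's argument. Modulo $f$ there are only finitely many residues $f(x^j)$, whereas
  $f(x^p) \equiv f(x)^p \pmod p$ makes the residue of $f(x^p)$ a multiple of $p$.
\<close>

lemma root_power_large_prime:
  fixes f :: "int poly"
  assumes monic: "lead_coeff f = 1" and m: "m > 0" and dvd: "f dvd monom 1 m - 1"
  obtains A where "\<And>p z. prime p \<Longrightarrow> p > A \<Longrightarrow> poly (cpoly f) z = 0 \<Longrightarrow> poly (cpoly f) (z ^ p) = 0"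
proof -
  have "\<exists>r. f dvd pcompose f (monom 1 j) - r \<and> (r = 0 \<or> degree r < degree f)" for j
    using monic_div_exists[OF monic, of "pcompose f (monom 1 j)"] by force
  then obtain r where r: "\<And>j. f dvd pcompose f (monom 1 j) - r j"
      and deg_r: "\<And>j. r j = 0 \<or> degree (r j) < degree f"
    by metis
  \<comment> \<open>A single bound for all p is possible because f divides x^m - 1: modulo f the
    exponent p may be replaced by p mod m, which leaves only the residues with j < m.\<close>
  define A where "A = Max (insert 0 ((\<lambda>(j, i). nat \<bar>coeff (r j) i\<bar>) ` ({..<m} \<times> {..degree f})))"
  have A: "nat \<bar>coeff (r j) i\<bar> \<le> A" if "j < m" for i j
  proof (cases "i \<le> degree f")
    case True
    then show ?thesis
      unfolding A_def using that by (intro Max_ge) auto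
  next
    case False
    then have "coeff (r j) i = 0"
      using deg_r[of j] by (auto simp: coeff_eq_0)
    then show ?thesis by simp
  qed
  have "f dvd pcompose f (monom 1 p)" if p: "prime p" "p > A" for p
  proof -
    define j where "j = p mod m"
    have "j < m"
      using m by (simp add: j_def)
    have "monom 1 m - 1 dvd monom 1 p - (monom 1 j :: int poly)"
    proof -
      have "monom 1 p - monom 1 j = monom 1 j * ((monom 1 m) ^ (p div m) - (1 :: int poly) ^ (p div m))"
        by (simp add: monom_power mult_monom j_def algebra_simps)
      also have "monom 1 m - (1 :: int poly) dvd \<dots>"
        by (intro dvd_mult) (simp add: power_diff_1_eq)
      finally show ?thesis .
    qed
    with dvd have "f dvd monom 1 p - monom 1 j"
      by (rule dvd_trans)
    then have 1: "f dvd pcompose f (monom 1 p) - pcompose f (monom 1 j)"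
      using dvd_pcompose_diff by (rule dvd_trans)
    \<comment> \<open>Modulo f the power f^p vanishes, so f(x^p) is congruent to p times the
      remainder \<open>s\<close> of \<open>g\<close>. It is also congruent to \<open>r j\<close>,
      and remainders of degree below that of f are unique.\<close>
    obtain g where g: "pcompose f (monom 1 p) - f ^ p = of_nat p * g"
      using prime_dvd_pcompose_monom[OF p(1), of f] by blast
    obtain u s where us: "g = f * u + s" and s: "s = 0 \<or> degree s < degree f"
      using monic_div_exists[OF monic, of g] by auto
    have "f dvd f ^ p"
      using p(1) by (simp add: dvd_power prime_gt_0_nat)
    moreover have "of_nat p * s - r j = (pcompose f (monom 1 j) - r j)
        + (pcompose f (monom 1 p) - pcompose f (monom 1 j)) - f ^ p - f * (of_nat p * u)"
      using g unfolding us by (simp add: algebra_simps)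
    ultimately have "f dvd of_nat p * s - r j"
      using r[of j] 1 by (simp only: dvd_diff dvd_add dvd_triv_left)
    moreover have "of_nat p * s = smult (int p) s"
      by (simp add: of_nat_poly)
    moreover have "smult (int p) s - r j = 0 \<or> degree (smult (int p) s - r j) < degree f"
    proof (cases "degree f = 0")
      case True
      then have "s = 0" "r j = 0"
        using s deg_r[of j] by auto
      then show ?thesis by simp
    next
      case False
      then have "degree (smult (int p) s) < degree f" "degree (r j) < degree f"
        using s deg_r[of j] by auto
      then show ?thesis
        by (simp add: degree_diff_less)
    qed
    ultimately have eq: "r j = smult (int p) s"
      using dvd_imp_eq_0_of_degree_less by fastforce
    have "r j = 0"
    proof (rule poly_eqI)
      fix i
      have "\<bar>coeff (r j) i\<bar> < int p"
        using A[OF \<open>j < m\<close>, of i] p(2) by linarith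
      moreover have "int p dvd coeff (r j) i"
        by (simp add: eq)
      ultimately show "coeff (r j) i = coeff 0 i"
        using dvd_imp_le_int[of "coeff (r j) i" "int p"] by fastforce
    qed
    with r[of j] 1 show ?thesis
      by (metis diff_0_right dvd_add_right_iff diff_add_cancel)
  qed
  moreover have "poly (cpoly (pcompose f (monom 1 p))) z = poly (cpoly f) (z ^ p)" for p z
  proof -
    have "cpoly (pcompose f (monom 1 p)) = pcompose (cpoly f) (monom 1 p)"
      by (induction f) (simp_all add: pcompose_pCons cpoly_add cpoly_mult cpoly_monom map_poly_pCons)
    then show ?thesis
      by (simp add: poly_pcompose poly_monom)
  qed
  ultimately show ?thesis
    using that[of A] cpoly_root_dvd by metis
qed

text \<open>A substitute for Dirichlet's theorem on primes in progressions. With l = k + m *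
  \<Prod>P, every prime p \<le> A divides exactly one of the two summands: if p divides k, it is
  coprime to m and lies outside \<open>P\<close>; otherwise it belongs to \<open>P\<close>. Hence no
  such p divides l.\<close>

lemma exists_cong_large_prime_factors:
  fixes k m A :: nat
  assumes "coprime k m" "m > 0"
  obtains l where "l > 0" "l mod m = k mod m" "\<And>p. prime p \<Longrightarrow> p dvd l \<Longrightarrow> p > A"
proof -
  define P where "P = {p. prime p \<and> p \<le> A \<and> \<not> p dvd k}"
  have fin: "finite P"
    unfolding P_def by (rule finite_subset[of _ "{..A}"]) auto
  define l where "l = k + m * \<Prod>P"
  have "\<Prod>P > 0"
    by (rule prod_pos) (auto simp: P_def prime_gt_0_nat)
  with \<open>m > 0\<close> have "l > 0"
    by (simp add: l_def)
  moreover have "l mod m = k mod m"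
    by (simp add: l_def)
  moreover have "p > A" if p: "prime p" "p dvd l" for p
  proof (rule ccontr)
    assume "\<not> p > A"
    show False
    proof (cases "p dvd k")
      case True
      with p have "p dvd m * \<Prod>P"
        by (simp add: l_def dvd_add_right_iff)
      then consider "p dvd m" | q where "q \<in> P" "p dvd q"
        using p(1) fin by (auto simp: prime_dvd_mult_iff prime_dvd_prod_iff)
      then show False
      proof cases
        case 1
        with True assms(1) p(1) show False
          by (metis coprime_common_divisor not_prime_unit)
      next
        case 2
        then have "p = q"
          using p(1) by (simp add: P_def primes_dvd_imp_eq)
        with 2 True show False
          by (simp add: P_def)
      qed
    next
      case False
      with p(1) \<open>\<not> p > A\<close> have "p \<in> P"
        by (simp add: P_def)
      with fin have "p dvd m * \<Prod>P"
        by (simp add: dvd_prod_eqI dvd_mult)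
      with p(2) False show False
        by (simp add: l_def dvd_add_left_iff)
    qed
  qed
  ultimately show ?thesis
    using that by blast
qed

text \<open>Since z^m = 1, the exponent k may be replaced by a congruent l all of whose prime
  factors are large; raising to these primes one after another stays among the roots of
  \<open>f\<close>.\<close>

lemma root_power_coprime:
  fixes f :: "int poly"
  assumes monic: "lead_coeff f = 1" and m: "m > 0" and dvd: "f dvd monom 1 m - 1"
    and z: "poly (cpoly f) z = 0" and k: "coprime k m"
  shows "poly (cpoly f) (z ^ k) = 0"
proof -
  obtain A where A: "\<And>p z. prime p \<Longrightarrow> p > A \<Longrightarrow> poly (cpoly f) z = 0 \<Longrightarrow> poly (cpoly f) (z ^ p) = 0"
    using root_power_large_prime[OF monic m dvd] by blast
  obtain l where l: "l > 0" "l mod m = k mod m" "\<And>p. prime p \<Longrightarrow> p dvd l \<Longrightarrow> p > A"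
    using exists_cong_large_prime_factors[OF k m] by blast
  have "poly (cpoly f) (w ^ l) = 0" if "poly (cpoly f) w = 0" for w
    using l(1,3) that
  proof (induction l arbitrary: w rule: less_induct)
    case (less l)
    show ?case
    proof (cases "l = 1")
      case False
      then obtain p where p: "prime p" "p dvd l"
        using prime_factor_nat by blast
      then obtain l' where l': "l = p * l'"
        by blast
      have "l' < l" "l' > 0"
        using less.prems(1) p(1) l' prime_gt_1_nat[of p] by auto
      then have "poly (cpoly f) ((w ^ p) ^ l') = 0"
        using less.IH[of l' "w ^ p"] less.prems l' A[OF p(1)] p by (auto simp: dvd_mult)
      then show ?thesis
        by (simp add: l' power_mult)
    qed (use less.prems in auto)
  qed
  then have "poly (cpoly f) (z ^ l) = 0"
    using z by blast
  moreover have "z ^ m = 1"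
    using cpoly_root_dvd[OF dvd z] by simp
  then have "z ^ l = z ^ k"
    using l(2) by (metis div_mult_mod_eq mult.commute power_add power_mult power_one mult_1)
  ultimately show ?thesis
    by simp
qed

text \<open>The leading coefficient of \<open>q\<close> divides that of \<open>f\<close> and is thus
  a unit; \<open>prime\<close> includes normalization, which makes this unit 1.\<close>

lemma exists_monic_prime_factor:
  fixes f :: "int poly"
  assumes f: "lead_coeff f dvd 1" and z: "poly (cpoly f) z = 0"
  obtains q where "prime q" "lead_coeff q = 1" "q dvd f" "poly (cpoly q) z = 0"
proof -
  have f0: "f \<noteq> 0"
    using f by auto
  have "\<exists>q. prime q \<and> q dvd f \<and> poly (cpoly q) z = 0"
    using f0 z
  proof (induction f rule: prime_divisors_induct)
    case (unit f)
    then show ?case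
      using cpoly_root_degree_pos[of f z] by (auto simp: is_unit_poly_iff map_poly_pCons)
  next
    case (factor p f)
    then have "poly (cpoly p) z = 0 \<or> poly (cpoly f) z = 0"
      by (simp add: cpoly_mult)
    with factor show ?case
      by fastforce
  qed simp
  then obtain q where q: "prime q" "q dvd f" "poly (cpoly q) z = 0"
    by blast
  have "lead_coeff q dvd 1"
    using q(2) f by (metis dvd_def dvd_trans lead_coeff_mult)
  moreover have "unit_factor q = 1"
    using q(1) by (metis normalize_prime prime_def unit_factor_normalize normalize_idem_imp_unit_factor_eq prime_elem_not_zeroI)
  then have "unit_factor (lead_coeff q) = 1"
    by (simp add: unit_factor_poly_def one_pCons)
  ultimately have "lead_coeff q = 1"
    by (metis is_unit_normalize mult_1 unit_factor_mult_normalize is_unit_unit_factor)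
  with q that show ?thesis
    by blast
qed

section \<open>Roots of unity and irreducibility of cyclotomic polynomials\<close>

abbreviation unity_root :: "nat \<Rightarrow> nat \<Rightarrow> complex" where
  "unity_root m j \<equiv> cis (2 * pi * real j / real m)"

lemma unity_root_mod:
  assumes "m > 0"
  shows "unity_root m (j mod m) = unity_root m j"
proof -
  have "real j = real m * real (j div m) + real (j mod m)"
    by (metis mult_div_mod_eq of_nat_add of_nat_mult)
  then have "2 * pi * real j / real m = 2 * pi * real (j div m) + 2 * pi * real (j mod m) / real m"
    using assms by (simp add: field_simps)
  then show ?thesis
    by (simp add: cis_multiple_2pi flip: cis_mult)
qed

lemma unity_root_power: "unity_root m j ^ n = unity_root m (j * n)"
proof -
  have "real n * (2 * pi * real j / real m) = 2 * pi * real (j * n) / real m"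
    by simp
  then show ?thesis
    by (simp only: Complex.DeMoivre)
qed

lemma unity_root_eq_1_iff:
  assumes "m > 0"
  shows "unity_root m j = 1 \<longleftrightarrow> m dvd j"
proof -
  have inj: "inj_on (unity_root m) {..<m}"
    using Complex.bij_betw_roots_unity[OF assms] by (auto simp: bij_betw_def)
  have "unity_root m (j mod m) = unity_root m 0 \<longleftrightarrow> j mod m = 0"
    by (rule inj_on_eq_iff[OF inj]) (use assms in auto)
  then show ?thesis
    using unity_root_mod[OF assms, of j] by (simp add: dvd_eq_mod_eq_0)
qed

lemma power_eq_1_imp_primitive_unity_root:
  fixes z :: complex
  assumes "z ^ n = 1" "n > 0"
  obtains m k where "m > 0" "k < m" "coprime k m" "z = unity_root m k"
proof -
  have "z \<in> unity_root n ` {..<n}"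
    using Complex.bij_betw_roots_unity[OF assms(2)] assms(1) by (auto simp: bij_betw_def)
  then obtain j where j: "j < n" "z = unity_root n j"
    by auto
  define d where "d = gcd j n"
  have d: "d > 0" "d dvd j" "d dvd n"
    using assms(2) by (auto simp: d_def)
  have "n div d > 0"
    using d assms(2) by (simp add: div_greater_zero_iff dvd_imp_le)
  moreover have "j div d < n div d"
    using d j(1) by (metis div_less_iff_less_mult dvd_div_mult_self)
  moreover have "coprime (j div d) (n div d)"
    using assms(2) unfolding d_def by (intro div_gcd_coprime) auto
  moreover have "z = unity_root (n div d) (j div d)"
    using j(2) d by (simp add: real_of_nat_div)
  ultimately show ?thesis
    using that by blast
qed

lemma rsquarefree_cpoly_of_dvd_monom_minus_one:
  assumes "f dvd monom 1 m - 1" "m > 0"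
  shows "rsquarefree (cpoly f)"
  unfolding rsquarefree_roots
proof (intro allI notI)
  fix z assume z: "poly (cpoly f) z = 0 \<and> poly (pderiv (cpoly f)) z = 0"
  obtain g where g: "monom 1 m - 1 = cpoly f * g"
    using cpoly_dvd[OF assms(1)] by (auto simp: cpoly_diff cpoly_monom)
  have "poly (pderiv (monom 1 m - 1)) z = 0" "poly (monom 1 m - 1) z = 0"
    using z unfolding g by (auto simp: pderiv_mult)
  then have "of_nat m * z ^ (m - 1) = 0" "z ^ m = 1"
    by (simp_all add: pderiv_diff pderiv_monom poly_monom)
  with assms(2) show False
    by (auto simp: power_0_left)
qed

lemma lead_coeff_monom_minus_one:
  assumes "m > 0"
  shows "lead_coeff (monom 1 m - 1 :: int poly) = 1"
proof -
  have "degree (monom 1 m - 1 :: int poly) = m"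
    using assms degree_add_eq_left[of "- 1" "monom 1 m :: int poly"] by (simp add: degree_monom_eq)
  with assms show ?thesis
    by simp
qed

text \<open>This yields integrality and irreducibility at once. Take the prime factor
  \<open>f\<close> of x^m - 1 that vanishes at one primitive root: its roots turn out to be exactly
  the primitive ones, and they are simple, so \<open>f\<close> is the complex product.\<close>

lemma exists_prime_cyclotomic:
  assumes m: "m > 0"
  obtains f where "prime f" "lead_coeff f = 1" "cpoly f = cyclotomic_complex m"
proof -
  have "lead_coeff (monom 1 m - 1 :: int poly) = 1"
    using m lead_coeff_monom_minus_one by blast
  moreover have "unity_root m 1 ^ m = 1"
    unfolding unity_root_power using unity_root_eq_1_iff[OF m, of "1 * m"] by simp
  then have "poly (cpoly (monom 1 m - 1)) (unity_root m 1) = 0"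
    by simp
  ultimately obtain f where f: "prime f" "lead_coeff f = 1" "f dvd monom 1 m - 1"
      "poly (cpoly f) (unity_root m 1) = 0"
    using exists_monic_prime_factor by (metis dvd_refl)
  have sub: "poly (cpoly f) (unity_root m k) = 0" if "coprime k m" for k
    using root_power_coprime[OF f(2) m f(3,4) that] unfolding unity_root_power by simp
  \<comment> \<open>A nonprimitive root has order dividing m/d for some d > 1. Then the prime
    \<open>f\<close> shares it with x^(m/d) - 1 and divides that polynomial, although
    \<open>unity_root m 1\<close> has order m.\<close>
  have "coprime k m" if k: "poly (cpoly f) (unity_root m k) = 0" for k
  proof (rule ccontr)
    assume "\<not> coprime k m"
    define d where "d = gcd k m"
    have d: "d > 1" "d dvd k" "d dvd m"
      using m \<open>\<not> coprime k m\<close> by (auto simp: d_def coprime_iff_gcd_eq_1 nat_neq_iff)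
    have n: "0 < m div d" "m div d < m"
      using m d by (auto simp: div_greater_zero_iff dvd_imp_le)
    have "m dvd k * (m div d)"
      using d by (metis div_mult_swap dvd_div_mult dvd_triv_right)
    then have "unity_root m k ^ (m div d) = 1"
      unfolding unity_root_power unity_root_eq_1_iff[OF m] .
    then have "poly (cpoly (monom 1 (m div d) - 1)) (unity_root m k) = 0"
      by simp
    with f(1) k have "f dvd monom 1 (m div d) - 1"
      by (intro prime_elem_dvd_of_common_root) auto
    then have "unity_root m 1 ^ (m div d) = 1"
      using cpoly_root_dvd f(4) by fastforce
    then have "m dvd m div d"
      using unity_root_eq_1_iff[OF m, of "1 * (m div d)"] by (simp only: unity_root_power) simp
    with n show False
      by (auto dest: dvd_imp_le)
  qed
  with sub have root: "poly (cpoly f) (unity_root m k) = 0 \<longleftrightarrow> coprime k m" for k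
    by blast
  have "{z. poly (cpoly f) z = 0} = unity_root m ` {k. k < m \<and> coprime k m}"
  proof -
    have "z ^ m = 1" if "poly (cpoly f) z = 0" for z
      using cpoly_root_dvd[OF f(3) that] by simp
    then have "{z. poly (cpoly f) z = 0} \<subseteq> unity_root m ` {..<m}"
      using Complex.bij_betw_roots_unity[OF m] by (auto simp: bij_betw_def)
    with root show ?thesis
      by auto
  qed
  moreover have "inj_on (unity_root m) {k. k < m \<and> coprime k m}"
    using Complex.bij_betw_roots_unity[OF m] by (auto simp: bij_betw_def inj_on_def)
  ultimately have "cyclotomic_complex m = (\<Prod>z | poly (cpoly f) z = 0. [:- z, 1:])"
    by (simp add: cyclotomic_complex_def prod.reindex)
  also have "\<dots> = smult (lead_coeff (cpoly f)) \<dots>"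
    using f(2) by simp
  also have "\<dots> = cpoly f"
    by (rule complex_poly_decompose_rsquarefree)
      (rule rsquarefree_cpoly_of_dvd_monom_minus_one[OF f(3) m])
  finally show ?thesis
    using that f(1,2) by metis
qed

lemma
  assumes "m > 0"
  shows cpoly_cyclotomic: "cpoly (cyclotomic m) = cyclotomic_complex m"
    and prime_cyclotomic: "prime (cyclotomic m)"
proof -
  obtain f where f: "prime f" "cpoly f = cyclotomic_complex m"
    using exists_prime_cyclotomic[OF assms] by metis
  have "cyclotomic m = f"
    unfolding cyclotomic_def by (rule the_equality) (use f(2) in \<open>auto simp: cpoly_eq_iff[symmetric]\<close>)
  with f show "cpoly (cyclotomic m) = cyclotomic_complex m" "prime (cyclotomic m)"
    by auto
qed

section \<open>The noncyclotomic part\<close>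

text \<open>In the prime factorization of \<open>F\<close>, let \<open>C\<close> collect the
  cyclotomic primes with multiplicity. Any admissible \<open>M\<close> has \<open>C\<close> as its
  image under \<open>cyclotomic\<close>, so cancelling \<open>prod_mset C\<close> shows that the
  cofactor is unique.\<close>

lemma noncyclotomic_part_spec:
  assumes "F \<noteq> 0"
  obtains M where "\<And>m. m \<in># M \<Longrightarrow> m \<ge> 1"
    "F = (\<Prod>m\<in>#M. cyclotomic m) * noncyclotomic_part F"
    "\<And>m. m \<ge> 1 \<Longrightarrow> \<not> cyclotomic m dvd noncyclotomic_part F"
proof -
  define cyc where "cyc = cyclotomic ` {1..}"
  define C where "C = filter_mset (\<lambda>q. q \<in> cyc) (prime_factorization F)"
  define G where "G = F div prod_mset C"
  define P where "P G \<longleftrightarrow> (\<exists>M. (\<forall>m\<in>#M. m \<ge> 1) \<and> F = (\<Prod>m\<in>#M. cyclotomic m) * G \<and>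
      (\<forall>m\<ge>1. \<not> cyclotomic m dvd G))" for G
  have C0: "prod_mset C \<noteq> 0"
    by (auto simp: C_def prod_mset_zero_iff)
  have "C \<subseteq># prime_factorization F"
    by (simp add: C_def)
  then have "prod_mset C dvd F"
    using assms by (metis prod_mset_prime_factorization_weak prod_mset_subset_imp_dvd dvd_normalize_iff)
  then have F: "F = prod_mset C * G"
    by (simp add: G_def)
  have G0: "G \<noteq> 0"
    using F assms by auto
  have "prime_factorization F = C + prime_factorization G"
  proof -
    have "prime_factorization (prod_mset C) = C"
      by (intro prime_factorization_prod_mset_primes) (auto simp: C_def)
    then show ?thesis
      using prime_factorization_mult[OF C0 G0] F by simp
  qed
  then have notin: "q \<notin># prime_factorization G" if "q \<in> cyc" for q
    using that unfolding C_def
    by (metis add_left_imp_eq filter_mset_add_mset filter_mset_eq_conv multiset_partition union_iff mem_Collect_eq set_mset_filter)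
  have "set_mset C \<subseteq> cyc"
    by (auto simp: C_def)
  then have "\<exists>M. C = image_mset cyclotomic M \<and> (\<forall>m\<in>#M. m \<ge> 1)"
  proof (induction C)
    case (add q C)
    then obtain M m where "C = image_mset cyclotomic M" "\<forall>m\<in>#M. m \<ge> 1" "q = cyclotomic m" "m \<ge> 1"
      by (auto simp: cyc_def)
    then show ?case
      by (intro exI[of _ "add_mset m M"]) auto
  qed auto
  moreover have "\<not> cyclotomic m dvd G" if "m \<ge> 1" for m
    using notin[of "cyclotomic m"] that G0 prime_cyclotomic[of m]
    by (auto simp: cyc_def in_prime_factors_iff)
  ultimately have "P G"
    using F by (auto simp: P_def)
  moreover have "G' = G" if G': "P G'" for G'
  proof -
    obtain M where M: "\<forall>m\<in>#M. m \<ge> 1" "F = (\<Prod>m\<in>#M. cyclotomic m) * G'"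
        "\<forall>m\<ge>1. \<not> cyclotomic m dvd G'"
      using G' by (auto simp: P_def)
    have "G' \<noteq> 0" and nz: "(\<Prod>m\<in>#M. cyclotomic m) \<noteq> 0"
      using M(2) assms by auto
    then have "prime_factorization F = image_mset cyclotomic M + prime_factorization G'"
      unfolding M(2) using M(1) prime_cyclotomic
      by (subst prime_factorization_mult, simp, simp, subst prime_factorization_prod_mset_primes)
        (auto simp: Suc_le_eq)
    moreover have "filter_mset (\<lambda>q. q \<in> cyc) (image_mset cyclotomic M) = image_mset cyclotomic M"
      using M(1) by (auto simp: filter_mset_eq_conv cyc_def)
    moreover have "filter_mset (\<lambda>q. q \<in> cyc) (prime_factorization G') = {#}"
      using M(3) by (auto simp: filter_mset_eq_conv cyc_def in_prime_factors_iff)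
    ultimately have "C = image_mset cyclotomic M"
      by (simp add: C_def)
    with M(2) F C0 show ?thesis
      by simp
  qed
  ultimately have "noncyclotomic_part F = G"
    unfolding noncyclotomic_part_def P_def[symmetric] by (intro the_equality)
  with \<open>P G\<close> have "P (noncyclotomic_part F)"
    by simp
  then show ?thesis
    unfolding P_def by (elim exE conjE) (rule that, auto)
qed

lemma noncyclotomic_part_no_unity_roots:
  assumes "F \<noteq> 0" "q dvd noncyclotomic_part F" "poly (cpoly q) z = 0" "n > 0"
  shows "z ^ n \<noteq> 1"
proof
  assume "z ^ n = 1"
  then obtain m k where mk: "m > 0" "k < m" "coprime k m" "z = unity_root m k"
    using power_eq_1_imp_primitive_unity_root assms(4) by blast
  have "poly (cpoly (cyclotomic m)) z = 0"
    using mk by (auto simp: cpoly_cyclotomic cyclotomic_complex_def poly_prod)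
  with mk(1) have "cyclotomic m dvd q"
    using prime_cyclotomic assms(3) by (intro prime_elem_dvd_of_common_root) auto
  then have "cyclotomic m dvd noncyclotomic_part F"
    using assms(2) by (rule dvd_trans)
  then show False
    using noncyclotomic_part_spec[OF assms(1)] mk(1) by (metis Suc_leI One_nat_def)
qed

section \<open>Ljunggren's argument\<close>

text \<open>In additive combinatorics this is a B_3 set. Three summands are what the comparison of
  the differences t, u and t - u requires.\<close>

definition unique_triple_sums :: "nat set \<Rightarrow> bool" where
  "unique_triple_sums S \<longleftrightarrow> (\<forall>a\<in>S. \<forall>b\<in>S. \<forall>c\<in>S. \<forall>d\<in>S. \<forall>e\<in>S. \<forall>f\<in>S.
     a + b + c = d + e + f \<longrightarrow> {#a, b, c#} = {#d, e, f#})"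

text \<open>Each nonzero t in \<open>T\<close> is a difference s t - s' t in \<open>S\<close>. Any
  two of these representations share an end, hence all of them share the same end. A common lower
  end must be 0 and gives T = S; a common upper end is the maximum and gives the mirror image. Equal
  cardinality turns the inclusions into equalities.\<close>

lemma unique_triple_sums_homometric:
  assumes S: "finite S" "0 \<in> S" "unique_triple_sums S"
    and T: "finite T" "0 \<in> T" "card T = card S" "card T > 1"
    and diff: "\<And>t t'. t \<in> T \<Longrightarrow> t' \<in> T \<Longrightarrow> t \<noteq> t' \<Longrightarrow>
        \<exists>s\<in>S. \<exists>s'\<in>S. s \<noteq> s' \<and> t + s' = t' + s"
  shows "T = S \<or> (T = (\<lambda>s. Max S - s) ` S)"
proof -
  define T' where "T' = T - {0}"
  have cardT': "card T' = card S - 1" and finT': "finite T'"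
    using T(1-3) by (simp_all add: T'_def)
  then have "T' \<noteq> {}"
    using T(3,4) by auto
  have "\<exists>s s'. s \<in> S \<and> s' \<in> S \<and> s \<noteq> s' \<and> t + s' = s" if "t \<in> T'" for t
    using diff[of t 0] that T(2) by (force simp: T'_def)
  then obtain s s' where ss: "\<And>t. t \<in> T' \<Longrightarrow> s t \<in> S" "\<And>t. t \<in> T' \<Longrightarrow> s' t \<in> S"
      "\<And>t. t \<in> T' \<Longrightarrow> s t \<noteq> s' t" "\<And>t. t \<in> T' \<Longrightarrow> t + s' t = s t"
    by metis
  have share: "s t = s u \<or> s' t = s' u" if tu: "t \<in> T'" "u \<in> T'" for t u
  proof (cases "t = u")
    case False
    then obtain x y where xy: "x \<in> S" "y \<in> S" "x \<noteq> y" "t + y = u + x"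
      using diff[of t u] tu by (auto simp: T'_def)
    \<comment> \<open>Writing t, u and t - u as differences in \<open>S\<close> and clearing signs
      gives two equal triple sums.\<close>
    have "s t + s' u + y = s u + s' t + x"
      using ss(4)[OF tu(1)] ss(4)[OF tu(2)] xy(4) by linarith
    then have "{#s t, s' u, y#} = {#s u, s' t, x#}"
      using S(3) ss(1,2) tu xy(1,2) unfolding unique_triple_sums_def by blast
    then have "s t \<in># {#s u, s' t, x#}" "{#s t, s' u, y#} = {#s u, s' t, x#}"
      by (auto simp flip: \<open>{#s t, s' u, y#} = {#s u, s' t, x#}\<close>)
    then consider "s t = s u" | "s t = x"
      using ss(3)[OF tu(1)] by auto
    then show ?thesis
    proof cases
      case 2
      then have "{#s' u, y#} = {#s u, s' t#}"
        using \<open>{#s t, s' u, y#} = {#s u, s' t, x#}\<close> by (simp add: add_mset_commute)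
      then show ?thesis
        using ss(3)[OF tu(2)] by (auto simp: add_eq_conv_ex)
    qed simp
  qed auto
  have "(\<exists>\<sigma>. \<forall>t\<in>T'. s t = \<sigma>) \<or> (\<exists>\<sigma>. \<forall>t\<in>T'. s' t = \<sigma>)"
  proof (rule ccontr)
    assume neg: "\<not> ((\<exists>\<sigma>. \<forall>t\<in>T'. s t = \<sigma>) \<or> (\<exists>\<sigma>. \<forall>t\<in>T'. s' t = \<sigma>))"
    \<comment> \<open>Here t and u agree in \<open>s'\<close>, while t and v agree in
      \<open>s\<close>; consequently u and v can agree in neither.\<close>
    then obtain t u where "t \<in> T'" "u \<in> T'" "s t \<noteq> s u"
      using neg by metis
    moreover obtain v where "v \<in> T'" "s' v \<noteq> s' t"
      using neg by metis
    ultimately show False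
      using share[of t u] share[of t v] share[of u v] by metis
  qed
  then show ?thesis
  proof (elim disjE exE)
    fix \<sigma> assume \<sigma>: "\<forall>t\<in>T'. s t = \<sigma>"
    have "\<sigma> \<in> S"
      using \<sigma> ss(1) \<open>T' \<noteq> {}\<close> by (metis ex_in_conv)
    have "inj_on s' T'"
    proof (rule inj_onI)
      fix t u assume "t \<in> T'" "u \<in> T'" "s' t = s' u"
      then show "t = u"
        using ss(4)[of t] ss(4)[of u] bspec[OF \<sigma>, of t] bspec[OF \<sigma>, of u] by linarith
    qed
    moreover have "s' ` T' \<subseteq> S - {\<sigma>}"
      using ss(2,3) \<sigma> by fastforce
    ultimately have img: "s' ` T' = S - {\<sigma>}"
      using cardT' S(1) \<open>\<sigma> \<in> S\<close> by (intro card_subset_eq) (auto simp: card_image)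
    have t: "t = \<sigma> - s' t" "s' t \<le> \<sigma>" if "t \<in> T'" for t
      using ss(4)[OF that] \<sigma> that by auto
    \<comment> \<open>Every other element of \<open>S\<close> is some \<open>s' t\<close>, so
      \<open>\<sigma>\<close> is the maximum, and the natural-number subtractions from
      \<open>\<sigma>\<close> are exact.\<close>
    have le: "x \<le> \<sigma>" if "x \<in> S" for x
    proof (cases "x = \<sigma>")
      case False
      with that img obtain t where "t \<in> T'" "x = s' t"
        by blast
      with t(2) show ?thesis
        by simp
    qed simp
    have "(\<lambda>t. \<sigma> - s' t) ` T' = (\<lambda>t. t) ` T'"
      by (intro image_cong refl) (rule t(1)[symmetric])
    then have "T' = (\<lambda>x. \<sigma> - x) ` (S - {\<sigma>})"
      unfolding img[symmetric] image_image by simp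
    then have "T = (\<lambda>x. \<sigma> - x) ` S"
      using T(2) \<open>\<sigma> \<in> S\<close> unfolding T'_def by (metis image_insert insert_Diff diff_self_eq_0)
    moreover have "Max S = \<sigma>"
      using le \<open>\<sigma> \<in> S\<close> S(1) by (intro Max_eqI) auto
    ultimately show ?thesis
      by simp
  next
    fix \<sigma> assume \<sigma>: "\<forall>t\<in>T'. s' t = \<sigma>"
    have "\<sigma> \<in> S"
      using \<sigma> ss(2) \<open>T' \<noteq> {}\<close> by (metis ex_in_conv)
    have "inj_on s T'"
    proof (rule inj_onI)
      fix t u assume "t \<in> T'" "u \<in> T'" "s t = s u"
      then show "t = u"
        using ss(4)[of t] ss(4)[of u] bspec[OF \<sigma>, of t] bspec[OF \<sigma>, of u] by linarith
    qed
    moreover have "s ` T' \<subseteq> S - {\<sigma>}"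
      using ss(1,3) \<sigma> by fastforce
    ultimately have img: "s ` T' = S - {\<sigma>}"
      using cardT' S(1) \<open>\<sigma> \<in> S\<close> by (intro card_subset_eq) (auto simp: card_image)
    have "\<sigma> = 0"
    proof (rule ccontr)
      assume "\<sigma> \<noteq> 0"
      then have "0 \<in> s ` T'"
        using img S(2) by auto
      then obtain t where "t \<in> T'" "s t = 0"
        by auto
      then show False
        using ss(4)[of t] by (auto simp: T'_def)
    qed
    then have "s ` T' = (\<lambda>t. t) ` T'"
      using ss(4) \<sigma> by (intro image_cong refl) fastforce
    with img \<open>\<sigma> = 0\<close> S(2) T(2) show ?thesis
      by (auto simp: T'_def)
  qed
qed

section \<open>Polynomials with coefficients 0 and 1, and reflection\<close>

definition set_poly :: "nat set \<Rightarrow> int poly" where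
  "set_poly S = (\<Sum>s\<in>S. monom 1 s)"

lemma coeff_set_poly:
  assumes "finite S"
  shows "coeff (set_poly S) n = of_bool (n \<in> S)"
  using assms by (simp add: set_poly_def coeff_sum of_bool_def)

lemma degree_set_poly:
  assumes "finite S" "S \<noteq> {}"
  shows "degree (set_poly S) = Max S"
proof (rule antisym)
  show "degree (set_poly S) \<le> Max S"
    using assms by (intro degree_le) (auto simp: coeff_set_poly)
  show "Max S \<le> degree (set_poly S)"
    using assms by (intro le_degree) (simp add: coeff_set_poly)
qed

lemma lead_coeff_set_poly:
  assumes "finite S" "S \<noteq> {}"
  shows "lead_coeff (set_poly S) = 1"
  using assms by (simp add: degree_set_poly coeff_set_poly)

lemma poly_set_poly_1: "poly (set_poly S) 1 = int (card S)"
  by (simp add: set_poly_def poly_sum poly_monom)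

lemma reflect_set_poly:
  assumes "finite S" "S \<noteq> {}"
  shows "reflect_poly (set_poly S) = set_poly ((\<lambda>s. Max S - s) ` S)"
proof (rule poly_eqI)
  fix n
  have "(n \<in> (\<lambda>s. Max S - s) ` S) \<longleftrightarrow> (n \<le> Max S \<and> Max S - n \<in> S)"
  proof
    assume "n \<in> (\<lambda>s. Max S - s) ` S"
    then obtain s where "s \<in> S" "n = Max S - s" by blast
    moreover have "s \<le> Max S"
      using assms \<open>s \<in> S\<close> by simp
    ultimately show "n \<le> Max S \<and> Max S - n \<in> S"
      by simp
  next
    assume "n \<le> Max S \<and> Max S - n \<in> S"
    then show "n \<in> (\<lambda>s. Max S - s) ` S"
      by (intro image_eqI[of _ _ "Max S - n"]) auto
  qed
  then show "coeff (reflect_poly (set_poly S)) n = coeff (set_poly ((\<lambda>s. Max S - s) ` S)) n"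
    using assms by (simp add: coeff_reflect_poly degree_set_poly coeff_set_poly flip: not_less)
qed

text \<open>The product with the reflection encodes the autocorrelation of the coefficients; for 0-1
  coefficients it counts the pairs of exponents at distance d.\<close>

lemma coeff_mult_reflect_poly:
  fixes p :: "'a :: comm_ring_1 poly"
  shows "coeff (p * reflect_poly p) (degree p + d) = (\<Sum>i\<le>degree p. coeff p (i + d) * coeff p i)"
proof -
  let ?n = "degree p"
  have "coeff (p * reflect_poly p) (?n + d) =
      (\<Sum>j\<le>?n + d. coeff (reflect_poly p) j * coeff p (?n + d - j))"
    by (subst mult.commute) (simp add: coeff_mult)
  also have "\<dots> = (\<Sum>j\<le>?n. coeff (reflect_poly p) j * coeff p (?n + d - j))"
    by (intro sum.mono_neutral_right) (auto simp: coeff_reflect_poly)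
  also have "\<dots> = (\<Sum>j\<le>?n. coeff p (?n - j + d) * coeff p (?n - j))"
    by (intro sum.cong) (auto simp: coeff_reflect_poly mult.commute)
  also have "\<dots> = (\<Sum>i\<le>?n. coeff p (i + d) * coeff p i)"
    by (rule sum.reindex_bij_witness[of _ "\<lambda>i. ?n - i" "\<lambda>i. ?n - i"]) auto
  finally show ?thesis .
qed

lemma poly_reflect_poly_1:
  fixes p :: "'a :: comm_ring_1 poly"
  shows "poly (reflect_poly p) 1 = poly p 1"
proof -
  have "poly (reflect_poly p) 1 = (\<Sum>i\<le>degree (reflect_poly p). coeff (reflect_poly p) i)"
    by (simp add: poly_altdef)
  also have "\<dots> = (\<Sum>i\<le>degree p. coeff (reflect_poly p) i)"
    using degree_reflect_poly_le[of p] by (intro sum.mono_neutral_left) (auto simp: coeff_eq_0)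
  also have "\<dots> = (\<Sum>i\<le>degree p. coeff p (degree p - i))"
    by (intro sum.cong) (auto simp: coeff_reflect_poly)
  also have "\<dots> = (\<Sum>i\<le>degree p. coeff p i)"
    by (rule sum.reindex_bij_witness[of _ "\<lambda>i. degree p - i" "\<lambda>i. degree p - i"]) auto
  finally show ?thesis
    by (simp add: poly_altdef)
qed

text \<open>
  Ljunggren's trick: the coefficients $w_i$ of $W$ satisfy $\sum w_i^2 = |S| = \sum w_i$,
  which forces every $w_i$ to be $0$ or $1$.
\<close>

lemma set_poly_mult_reflect_eq:
  assumes S: "finite S" "0 \<in> S" "unique_triple_sums S" "card S > 1"
    and W: "W * reflect_poly W = set_poly S * reflect_poly (set_poly S)"
      "poly W 1 = int (card S)" "coeff W 0 \<noteq> 0"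
  shows "W = set_poly S \<or> W = reflect_poly (set_poly S)"
proof -
  define F where "F = set_poly S"
  have S': "S \<noteq> {}"
    using S(2) by auto
  have F0: "F \<noteq> 0" "coeff F 0 \<noteq> 0"
    using S by (auto simp: F_def coeff_set_poly dest: arg_cong[where f = "\<lambda>p. coeff p 0"])
  have W0: "W \<noteq> 0"
    using W(3) by auto
  \<comment> \<open>Nonzero constant coefficients ensure that reflection preserves the
    degree.\<close>
  have "degree (W * reflect_poly W) = 2 * degree W" "degree (F * reflect_poly F) = 2 * degree F"
    using W0 W(3) F0 by (simp_all add: degree_mult_eq)
  then have deg: "degree W = degree F"
    using W(1) by (simp add: F_def)
  have eq: "(\<Sum>i\<le>degree F. coeff W (i + d) * coeff W i) = (\<Sum>i\<le>degree F. coeff F (i + d) * coeff F i)" for d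
    using coeff_mult_reflect_poly[of W d] coeff_mult_reflect_poly[of F d] W(1) deg by (simp add: F_def)
  have "(\<Sum>i\<le>degree F. coeff F i * coeff F i) = (\<Sum>i\<le>degree F. coeff F i)"
    using S by (intro sum.cong) (auto simp: F_def coeff_set_poly)
  also have "\<dots> = poly W 1"
    using poly_set_poly_1[of S] W(2) by (simp add: F_def poly_altdef)
  finally have "(\<Sum>i\<le>degree F. coeff W i * coeff W i - coeff W i) = 0"
    using eq[of 0] deg by (simp add: sum_subtractf poly_altdef)
  moreover have "x * x - x \<ge> 0" for x :: int
    using zero_le_mult_iff[of x "x - 1"] by (auto simp: algebra_simps)
  ultimately have "coeff W i * coeff W i - coeff W i = 0" if "i \<le> degree F" for i
    using that by (subst (asm) sum_nonneg_eq_0_iff) auto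
  then have "coeff W i * (coeff W i - 1) = 0" if "i \<le> degree F" for i
    using that by (simp add: algebra_simps)
  then have W01: "coeff W i = 0 \<or> coeff W i = 1" for i
    by (cases "i \<le> degree F") (auto simp: coeff_eq_0 deg)
  define T where "T = {i. coeff W i \<noteq> 0}"
  have finT: "finite T"
    unfolding T_def by (rule finite_subset[of _ "{..degree W}"]) (auto simp: le_degree)
  have WT: "W = set_poly T"
    using W01 finT by (intro poly_eqI) (auto simp: coeff_set_poly T_def)
  have cardT: "card T = card S"
    using W(2) by (simp add: WT poly_set_poly_1)
  have "0 \<in> T"
    using W(3) by (simp add: T_def)
  \<comment> \<open>A difference d occurring in \<open>T\<close> makes the autocorrelation at d
    positive; it is the same for \<open>S\<close>, so d occurs in \<open>S\<close> too.\<close>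
  have less: "\<exists>s\<in>S. \<exists>s'\<in>S. s \<noteq> s' \<and> t + s' = t' + s" if tt: "t \<in> T" "t' \<in> T" "t' < t" for t t'
  proof -
    define d where "d = t - t'"
    have "t' \<le> degree F"
      using tt(2) deg le_degree[of W t'] by (simp add: T_def)
    have "0 < coeff W (t' + d) * coeff W t'"
      using tt W01[of t] W01[of t'] by (auto simp: T_def d_def)
    also have "\<dots> \<le> (\<Sum>i\<le>degree F. coeff W (i + d) * coeff W i)"
      using finT \<open>t' \<le> degree F\<close>
      by (intro member_le_sum[of t' _ "\<lambda>i. coeff W (i + d) * coeff W i"]) (auto simp: WT coeff_set_poly)
    also have "\<dots> = (\<Sum>i\<le>degree F. coeff F (i + d) * coeff F i)"
      by (rule eq)
    finally obtain i where "coeff F (i + d) * coeff F i \<noteq> 0"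
      by (metis (no_types, lifting) less_irrefl sum.neutral)
    then have "i + d \<in> S" "i \<in> S"
      using S(1) by (auto simp: F_def coeff_set_poly)
    then show ?thesis
      using tt(3) by (intro bexI[of _ "i + d"] bexI[of _ i]) (auto simp: d_def)
  qed
  have "\<exists>s\<in>S. \<exists>s'\<in>S. s \<noteq> s' \<and> t + s' = t' + s" if tt: "t \<in> T" "t' \<in> T" "t \<noteq> t'" for t t'
    using less[of t t'] less[of t' t] tt by (metis nat_neq_iff)
  then have "T = S \<or> T = (\<lambda>s. Max S - s) ` S"
    using S finT \<open>0 \<in> T\<close> cardT by (intro unique_triple_sums_homometric) auto
  then show ?thesis
    using S S' by (auto simp: WT reflect_set_poly)
qed

section \<open>From rational reducibility to a shared factor\<close>

lemma rat_poly_clear_denominators: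
  fixes p :: "rat poly"
  obtains d q where "d \<noteq> 0" "smult (of_int d) p = map_poly of_int q"
proof -
  have "\<exists>d q. d \<noteq> 0 \<and> smult (of_int d) p = map_poly of_int q"
  proof (induction p)
    case 0
    show ?case
      by (intro exI[of _ 1] exI[of _ 0]) simp
  next
    case (pCons a p)
    then obtain d q where dq: "d \<noteq> 0" "smult (of_int d) p = map_poly of_int q"
      by blast
    obtain x y where xy: "quotient_of a = (x, y)"
      by force
    then have a: "a = of_int x / of_int y" and "y \<noteq> 0"
      using quotient_of_div quotient_of_denom_pos[OF xy] by auto
    have "smult (of_int (y * d)) (pCons a p) = pCons (of_int (x * d)) (smult (of_int y) (smult (of_int d) p))"
      using \<open>y \<noteq> 0\<close> by (simp add: a mult_ac)
    also have "\<dots> = map_poly of_int (pCons (x * d) (smult y q))"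
      by (simp add: dq(2) map_poly_pCons map_poly_smult)
    finally show ?case
      using dq(1) \<open>y \<noteq> 0\<close> by (intro exI[of _ "y * d"] exI[of _ "pCons (x * d) (smult y q)"]) simp
  qed
  then show ?thesis
    using that by blast
qed

text \<open>Gauss's lemma. Primitive parts multiply, so of the cleared denominator
  \<open>d * e\<close> only its sign \<open>u\<close> survives; together with the content of
  \<open>G\<close> it is put on the first factor.\<close>

lemma reducible_poly_imp_int_factors:
  fixes G :: "int poly"
  assumes "reducible_poly (map_poly (of_int :: int \<Rightarrow> rat) G)"
  obtains g h where "G = g * h" "degree g > 0" "degree h > 0"
proof -
  obtain p q where pq: "map_poly of_int G = p * (q :: rat poly)" "degree p > 0" "degree q > 0"
    using assms by (auto simp: reducible_poly_def Suc_le_eq)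
  obtain d g where dg: "d \<noteq> 0" "smult (of_int d) p = map_poly of_int g"
    using rat_poly_clear_denominators by blast
  obtain e h where eh: "e \<noteq> 0" "smult (of_int e) q = map_poly of_int h"
    using rat_poly_clear_denominators by blast
  have deg: "degree g > 0" "degree h > 0"
    using arg_cong[OF dg(2), of degree] arg_cong[OF eh(2), of degree] dg(1) eh(1) pq(2,3)
    by (simp_all add: degree_map_poly)
  have "map_poly (of_int :: int \<Rightarrow> rat) (smult (d * e) G) = smult (of_int d) p * smult (of_int e) q"
    using pq(1) by (simp add: map_poly_smult mult_ac)
  also have "\<dots> = map_poly of_int (g * h)"
    unfolding dg(2) eh(2) by (intro poly_eqI) (simp add: coeff_map_poly coeff_mult)
  finally have "map_poly (of_int :: int \<Rightarrow> rat) (smult (d * e) G - g * h) = 0"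
    by (simp add: poly_eq_iff coeff_map_poly flip: of_int_mult)
  then have eq: "smult (d * e) G = g * h"
    by (simp add: map_poly_eq_0_iff)
  have "G \<noteq> 0"
    using pq by auto
  define u where "u = sgn (d * e)"
  have u: "u * u = 1"
    using dg(1) eh(1) by (simp add: u_def sgn_if)
  have "smult u (primitive_part G) = primitive_part g * primitive_part h"
    using arg_cong[OF eq, of primitive_part]
    by (simp only: primitive_part_smult primitive_part_mult u_def unit_factor_int_def)
  then have "smult u (smult u (primitive_part G)) = smult u (primitive_part g * primitive_part h)"
    by simp
  then have "primitive_part G = smult u (primitive_part g) * primitive_part h"
    by (simp add: u)
  then have "G = smult (content G) (smult u (primitive_part g) * primitive_part h)"
    by (metis content_times_primitive_part)
  then have "G = smult (content G * u) (primitive_part g) * primitive_part h"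
    by simp
  moreover have "content G * u \<noteq> 0"
    using u \<open>G \<noteq> 0\<close> by auto
  ultimately show ?thesis
    using that deg by (metis degree_smult_eq degree_primitive_part)
qed

text \<open>Being monic serves the finiteness of small-degree factors; the condition on roots lets
  \<open>q\<close> determine the last exponent.\<close>

definition is_noncyclotomic_factor :: "int poly \<Rightarrow> int poly \<Rightarrow> bool" where
  "is_noncyclotomic_factor q F \<longleftrightarrow> prime q \<and> lead_coeff q = 1 \<and> degree q > 0 \<and> q dvd F \<and>
     (\<forall>z n. n > 0 \<longrightarrow> poly (cpoly q) z = 0 \<longrightarrow> z ^ n \<noteq> 1)"

text \<open>With F = A h, either alternative exhibits a self-reciprocal factor: if A times the
  reflection of h is F, then h equals its reflection; if it is the reflection of F, then A equals
  its own. The cyclotomic factors are absorbed into \<open>A\<close>, but \<open>q\<close> is taken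
  from \<open>g\<close> or \<open>h\<close>, which divide the noncyclotomic part.\<close>

lemma common_factor_of_reducible:
  assumes S: "finite S" "0 \<in> S" "unique_triple_sums S" "card S > 1"
    and red: "reducible_poly (map_poly (of_int :: int \<Rightarrow> rat) (noncyclotomic_part (set_poly S)))"
  obtains q where "is_noncyclotomic_factor q (set_poly S)" "q dvd reflect_poly (set_poly S)"
proof -
  define F where "F = set_poly S"
  have "S \<noteq> {}"
    using S(2) by auto
  then have lcF: "lead_coeff F = 1"
    using S(1) by (simp add: F_def lead_coeff_set_poly)
  have "coeff F 0 = 1"
    using S(1,2) by (simp add: F_def coeff_set_poly)
  then have F0: "F \<noteq> 0" "coeff F 0 = 1"
    by auto
  obtain M where F: "F = (\<Prod>m\<in>#M. cyclotomic m) * noncyclotomic_part F"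
    using noncyclotomic_part_spec[OF F0(1)] by metis
  obtain g h where gh: "noncyclotomic_part F = g * h" "degree g > 0" "degree h > 0"
    using reducible_poly_imp_int_factors[OF red] by (auto simp: F_def)
  define A where "A = (\<Prod>m\<in>#M. cyclotomic m) * g"
  have FA: "F = A * h"
    using F gh by (simp add: A_def mult_ac)
  have A0: "A \<noteq> 0" "h \<noteq> 0" "coeff A 0 \<noteq> 0" "coeff h 0 \<noteq> 0"
    using F0 by (auto simp: FA coeff_mult)
  have factor: "\<exists>q. is_noncyclotomic_factor q F \<and> q dvd f"
    if f: "f dvd noncyclotomic_part F" "degree f > 0" for f
  proof -
    have "f dvd F"
      using f(1) F by (metis dvd_mult)
    then have "lead_coeff f dvd 1"
      using lcF by (metis dvd_def lead_coeff_mult)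
    moreover obtain z where z: "poly (cpoly f) z = 0"
      using cpoly_root_exists f(2) by blast
    ultimately obtain q where q: "prime q" "lead_coeff q = 1" "q dvd f" "poly (cpoly q) z = 0"
      using exists_monic_prime_factor by blast
    have "q \<noteq> 0"
      using q(1) by auto
    with q \<open>f dvd F\<close> f(1) F0(1) show ?thesis
      unfolding is_noncyclotomic_factor_def
      by (meson cpoly_root_degree_pos dvd_trans noncyclotomic_part_no_unity_roots)
  qed
  have "A * reflect_poly h = F \<or> A * reflect_poly h = reflect_poly F"
    unfolding F_def
  proof (rule set_poly_mult_reflect_eq[OF S])
    show "A * reflect_poly h * reflect_poly (A * reflect_poly h) =
        set_poly S * reflect_poly (set_poly S)"
      using A0(4) by (simp add: reflect_poly_mult FA mult_ac flip: F_def)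
    have "poly (A * reflect_poly h) 1 = poly F 1"
      by (simp add: FA poly_reflect_poly_1)
    then show "poly (A * reflect_poly h) 1 = int (card S)"
      by (simp add: F_def poly_set_poly_1)
    show "coeff (A * reflect_poly h) 0 \<noteq> 0"
      using A0 by (simp add: coeff_mult)
  qed
  then have "\<exists>q. is_noncyclotomic_factor q F \<and> q dvd reflect_poly F"
  proof
    assume "A * reflect_poly h = F"
    then have "reflect_poly h = h"
      using A0(1) by (simp add: FA)
    then have "h dvd reflect_poly F"
      by (metis FA reflect_poly_mult dvd_triv_right)
    with factor[of h] gh show ?thesis
      using dvd_trans by (metis dvd_triv_right)
  next
    assume "A * reflect_poly h = reflect_poly F"
    then have "reflect_poly A = A"
      using A0(2) by (simp add: FA reflect_poly_mult)
    then have "A dvd reflect_poly F"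
      by (metis FA reflect_poly_mult dvd_triv_left)
    then have "g dvd reflect_poly F"
      unfolding A_def by (rule dvd_mult_right)
    with factor[of g] gh show ?thesis
      using dvd_trans by (metis dvd_triv_left)
  qed
  then show ?thesis
    using that by (auto simp: F_def)
qed

section \<open>Bounds on roots and finiteness of small-degree factors\<close>

lemma cpoly_reflect: "cpoly (reflect_poly p) = reflect_poly (cpoly p)"
  by (intro poly_eqI) (simp add: coeff_reflect_poly)

lemma cpoly_set_poly: "poly (cpoly (set_poly S)) z = (\<Sum>s\<in>S. z ^ s)"
proof (induction S rule: infinite_finite_induct)
  case (insert s S)
  then have "set_poly (insert s S) = monom 1 s + set_poly S"
    by (simp add: set_poly_def)
  with insert show ?case
    by (simp add: cpoly_add cpoly_monom poly_monom)
qed (simp_all add: set_poly_def)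

text \<open>For |z| \<ge> 2 a geometric sum bounds the lower terms by |z|^n - 1, too little to
  cancel the top term. The bound is uniform in \<open>S\<close>.\<close>

lemma cmod_root_set_poly_less:
  assumes S: "finite S" "S \<noteq> {}" and z: "poly (cpoly (set_poly S)) z = 0"
  shows "cmod z < 2"
proof (rule ccontr)
  assume "\<not> cmod z < 2"
  then have z2: "cmod z \<ge> 2" by simp
  define n where "n = Max S"
  have n: "n \<in> S"
    using S by (simp add: n_def)
  have "z ^ n + (\<Sum>s\<in>S - {n}. z ^ s) = 0"
    using z S(1) n by (simp add: cpoly_set_poly sum.remove)
  then have "cmod z ^ n = cmod (\<Sum>s\<in>S - {n}. z ^ s)"
    by (metis add_eq_0_iff norm_minus_cancel norm_power)
  also have "\<dots> \<le> (\<Sum>s\<in>S - {n}. cmod z ^ s)"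
    by (rule order_trans[OF norm_sum]) (simp add: norm_power)
  also have "\<dots> \<le> (\<Sum>s<n. cmod z ^ s)"
  proof (intro sum_mono2)
    show "S - {n} \<subseteq> {..<n}"
      using S(1) Max_ge[of S] by (force simp: n_def order_less_le)
  qed auto
  also have "\<dots> = (cmod z ^ n - 1) / (cmod z - 1)"
    using z2 by (intro geometric_sum) auto
  also have "\<dots> \<le> cmod z ^ n - 1"
    using z2 one_le_power[of "cmod z" n] mult_left_mono[of 1 "cmod z - 1" "cmod z ^ n - 1"]
    by (simp add: divide_le_eq)
  finally show False
    by simp
qed

text \<open>Values replace coefficients here: at 0, ..., D - 1 the polynomial takes integer values,
  bounded through its factorization into linear factors, and these D values determine a polynomial
  of degree below D.\<close>

lemma finite_monic_bounded_roots:
  fixes r :: real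
  assumes "r \<ge> 0"
  shows "finite {q :: int poly. degree q < D \<and> lead_coeff q = 1 \<and> (\<forall>z. poly (cpoly q) z = 0 \<longrightarrow> cmod z \<le> r)}"
    (is "finite ?K")
proof -
  \<comment> \<open>The summand 1 keeps the base at least 1, so the exponent \<open>degree q\<close>
    may be raised to \<open>D\<close>.\<close>
  define B where "B = (\<lambda>j. \<lceil>(real j + r + 1) ^ D\<rceil>)"
  define ev where "ev = (\<lambda>q :: int poly. \<lambda>j\<in>{..<D}. poly q (int j))"
  have bound: "\<bar>poly q (int j)\<bar> \<le> B j" if q: "q \<in> ?K" for q j
  proof -
    obtain root where root: "smult (lead_coeff (cpoly q)) (\<Prod>i<degree (cpoly q). [:- root i, 1:]) = cpoly q"
      using complex_poly_decompose' by blast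
    then have prod: "cpoly q = (\<Prod>i<degree q. [:- root i, 1:])"
      using q by simp
    have "poly (cpoly q) (root i) = 0" if "i < degree q" for i
      unfolding prod poly_prod using that by (intro prod_zero) auto
    then have le: "cmod (root i) \<le> r" if "i < degree q" for i
      using q that by blast
    have "real_of_int \<bar>poly q (int j)\<bar> = cmod (of_int (poly q (int j)))"
      by simp
    also have "of_int (poly q (int j)) = poly (cpoly q) (of_nat j)"
      by (simp add: poly_altdef)
    also have "cmod \<dots> = (\<Prod>i<degree q. cmod (of_nat j - root i))"
      unfolding prod poly_prod by (simp add: norm_mult flip: prod_norm)
    also have "\<dots> \<le> (\<Prod>i<degree q. real j + r + 1)"
    proof (intro prod_mono conjI)
      fix i assume "i \<in> {..<degree q}"
      then show "cmod (of_nat j - root i) \<le> real j + r + 1"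
        using norm_triangle_ineq4[of "of_nat j" "root i"] le[of i] by simp
    qed auto
    also have "\<dots> = (real j + r + 1) ^ degree q"
      by simp
    also have "\<dots> \<le> (real j + r + 1) ^ D"
      using q assms by (intro power_increasing) auto
    finally show ?thesis
      unfolding B_def by linarith
  qed
  have "ev ` ?K \<subseteq> (\<Pi>\<^sub>E j\<in>{..<D}. {-B j..B j})"
  proof (intro image_subsetI PiE_I)
    fix q j assume q: "q \<in> ?K" and "j \<in> {..<D}"
    then show "ev q j \<in> {-B j..B j}"
      using bound[OF q, of j] by (auto simp: ev_def abs_le_iff)
  qed (simp add: ev_def)
  then have "finite (ev ` ?K)"
    by (rule finite_subset) (intro finite_PiE, auto)
  moreover have "inj_on ev ?K"
  proof (rule inj_onI)
    fix p q assume pq: "p \<in> ?K" "q \<in> ?K" "ev p = ev q"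
    show "p = q"
    proof (rule poly_eqI_degree[of "int ` {..<D}"])
      fix x assume "x \<in> int ` {..<D}"
      then obtain j where "j < D" "x = int j"
        by auto
      then show "poly p x = poly q x"
        using fun_cong[OF pq(3), of j] by (simp add: ev_def)
    qed (use pq(1,2) in \<open>simp_all add: card_image\<close>)
  qed
  ultimately show ?thesis
    by (rule finite_imageD)
qed

text \<open>Distinct normalized primes are not associated, so after dividing \<open>R\<close> by one
  of them the others still divide the quotient.\<close>

lemma sum_degree_primes_le:
  fixes R :: "int poly"
  assumes "finite X" "R \<noteq> 0" "\<And>q. q \<in> X \<Longrightarrow> prime q \<and> q dvd R"
  shows "(\<Sum>q\<in>X. degree q) \<le> degree R"
  using assms
proof (induction X arbitrary: R rule: finite_induct)
  case (insert q X)
  then obtain R' where R: "R = q * R'"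
    by blast
  then have "R' \<noteq> 0" "q \<noteq> 0"
    using insert.prems(1) by auto
  have "prime p \<and> p dvd R'" if p: "p \<in> X" for p
  proof -
    have "prime p" "p dvd q * R'" "prime q" "p \<noteq> q"
      using insert p R by auto
    then show ?thesis
      using primes_dvd_imp_eq by (metis prime_dvd_mult_iff)
  qed
  with insert.IH[OF \<open>R' \<noteq> 0\<close>] have "(\<Sum>q\<in>X. degree q) \<le> degree R'"
    by blast
  then show ?case
    using insert.hyps \<open>R' \<noteq> 0\<close> \<open>q \<noteq> 0\<close> by (simp add: R degree_mult_eq)
qed simp

section \<open>Counting exceptional exponents\<close>

definition common_factor_exponents :: "nat set \<Rightarrow> nat set" where
  "common_factor_exponents S = {n. n > Max S \<and> (\<exists>q. is_noncyclotomic_factor q (set_poly (insert n S)) \<and>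
     q dvd reflect_poly (set_poly (insert n S)))}"

lemma noncyclotomic_factor_root:
  assumes q: "is_noncyclotomic_factor q (set_poly S)" and S: "finite S" "0 \<in> S"
  obtains z where "poly (cpoly q) z = 0" "poly (cpoly (set_poly S)) z = 0" "z \<noteq> 0"
    "\<And>n. n > 0 \<Longrightarrow> z ^ n \<noteq> 1"
proof -
  obtain z where z: "poly (cpoly q) z = 0"
    using q cpoly_root_exists by (auto simp: is_noncyclotomic_factor_def)
  moreover have F: "poly (cpoly (set_poly S)) z = 0"
    using q z by (auto simp: is_noncyclotomic_factor_def intro: cpoly_root_dvd)
  moreover have "z \<noteq> 0"
    using F S by (auto simp: poly_0_coeff_0 coeff_set_poly)
  ultimately show ?thesis
    using q that by (auto simp: is_noncyclotomic_factor_def)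
qed

text \<open>
  A root $z$ of $q$ satisfies $P(z) = -z^n$ and $P(1/z) = -z^{-n}$, where $P$ is the
  polynomial of $S$; so $P(z) P(1/z) = 1$ no longer involves $n$.
\<close>

lemma common_factor_dvd:
  assumes S: "finite S" "0 \<in> S" and n: "n > Max S"
    and q: "is_noncyclotomic_factor q (set_poly (insert n S))" "q dvd reflect_poly (set_poly (insert n S))"
  shows "q dvd set_poly S * reflect_poly (set_poly S) - monom 1 (Max S)"
proof -
  define P where "P = set_poly S"
  have "n \<notin> S"
    using n S by (meson Max_ge not_less)
  then have F: "set_poly (insert n S) = P + monom 1 n"
    using S by (simp add: set_poly_def P_def)
  have degP: "degree P = Max S"
    using S by (subst P_def, intro degree_set_poly) auto
  obtain z where z: "poly (cpoly q) z = 0" "poly (cpoly (P + monom 1 n)) z = 0" "z \<noteq> 0"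
    using noncyclotomic_factor_root[OF q(1)] S unfolding F by auto
  have 1: "poly (cpoly P) z = - (z ^ n)"
    using z(2) by (simp add: cpoly_add cpoly_monom poly_monom add_eq_0_iff2)
  have "poly (reflect_poly (cpoly (P + monom 1 n))) z = 0"
    using cpoly_root_dvd[OF q(2) z(1)] by (simp add: F cpoly_reflect)
  then have "poly (cpoly P) (inverse z) + inverse z ^ n = 0"
    using z(3) by (simp add: poly_reflect_poly_nz cpoly_add cpoly_monom poly_monom)
  then have 2: "poly (cpoly P) (inverse z) = - inverse (z ^ n)"
    by (simp add: add_eq_0_iff2 power_inverse)
  have "poly (cpoly (P * reflect_poly P - monom 1 (Max S))) z
     = poly (cpoly P) z * (z ^ Max S * poly (cpoly P) (inverse z)) - z ^ Max S"
    using z(3) by (simp add: cpoly_diff cpoly_mult cpoly_reflect cpoly_monom poly_monom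
        poly_reflect_poly_nz degP)
  also have "\<dots> = 0"
    using z(3) by (simp add: 1 2)
  finally show ?thesis
    using q(1) z(1) unfolding P_def
    by (intro prime_elem_dvd_of_common_root) (auto simp: is_noncyclotomic_factor_def)
qed

text \<open>At a common root z, both z^n and z^m equal minus the value of \<open>set_poly S\<close>,
  and z is neither 0 nor a root of unity. Equality of the exponents follows by symmetry.\<close>

lemma common_factor_exponent_unique:
  assumes S: "finite S" "0 \<in> S" and n: "n > Max S" "m > Max S"
    and q: "is_noncyclotomic_factor q (set_poly (insert n S))" "is_noncyclotomic_factor q (set_poly (insert m S))"
  shows "n \<le> m"
proof (rule ccontr)
  assume "\<not> n \<le> m"
  have notin: "n \<notin> S" "m \<notin> S"
    using n S by (meson Max_ge not_less)+
  obtain z where z: "poly (cpoly q) z = 0" "poly (cpoly (set_poly (insert n S))) z = 0" "z \<noteq> 0"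
      "\<And>n. n > 0 \<Longrightarrow> z ^ n \<noteq> 1"
    using noncyclotomic_factor_root[OF q(1)] S by auto
  have "poly (cpoly (set_poly (insert m S))) z = 0"
    using q(2) z(1) by (auto simp: is_noncyclotomic_factor_def intro: cpoly_root_dvd)
  then have "z ^ n = z ^ m"
    using z(2) S notin by (simp add: cpoly_set_poly add_eq_0_iff2)
  then have "z ^ m * z ^ (n - m) = z ^ m * 1"
    using \<open>\<not> n \<le> m\<close> by (simp flip: power_add)
  then have "z ^ (n - m) = 1"
    using z(3) by (simp only: mult_cancel_left) simp
  with z(4)[of "n - m"] \<open>\<not> n \<le> m\<close> show False
    by simp
qed

lemma card_common_factor_exponents:
  assumes S: "finite S" "0 \<in> S" "card S > 1" "S \<subseteq> {..N}"
    and D: "D > 0"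
  defines "K \<equiv> {q :: int poly. degree q < D \<and> lead_coeff q = 1 \<and> (\<forall>z. poly (cpoly q) z = 0 \<longrightarrow> cmod z \<le> 2)}"
  shows "finite (common_factor_exponents S)"
    and "real (card (common_factor_exponents S)) \<le> 2 * real N / real D + real (card K)"
proof -
  define X where "X = common_factor_exponents S"
  define R where "R = set_poly S * reflect_poly (set_poly S) - monom 1 (Max S)"
  have "S \<noteq> {}"
    using S(2) by auto
  have finK: "finite K"
    unfolding K_def by (rule finite_monic_bounded_roots) simp
  have "Max S \<le> N"
    using S \<open>S \<noteq> {}\<close> by (simp add: subset_iff)
  have "\<exists>q. is_noncyclotomic_factor q (set_poly (insert n S)) \<and>
      q dvd reflect_poly (set_poly (insert n S))" if "n \<in> X" for n
    using that by (auto simp: X_def common_factor_exponents_def)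
  then obtain q where q: "\<And>n. n \<in> X \<Longrightarrow> is_noncyclotomic_factor (q n) (set_poly (insert n S))"
      "\<And>n. n \<in> X \<Longrightarrow> q n dvd reflect_poly (set_poly (insert n S))"
    by metis
  have Max: "n > Max S" if "n \<in> X" for n
    using that by (simp add: X_def common_factor_exponents_def)
  have inj: "inj_on q X"
  proof (rule inj_onI)
    fix n m assume nm: "n \<in> X" "m \<in> X" "q n = q m"
    then have "is_noncyclotomic_factor (q n) (set_poly (insert n S))"
        "is_noncyclotomic_factor (q n) (set_poly (insert m S))"
      using q(1) by metis+
    then show "n = m"
      using common_factor_exponent_unique[OF S(1,2)] Max nm(1,2) by (meson antisym)
  qed
  have dvdR: "q n dvd R" if "n \<in> X" for n
    unfolding R_def using common_factor_dvd[OF S(1,2) Max q(1) q(2)] that by blast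
  \<comment> \<open>The degree count needs R to be nonzero, and R(1) = |S|^2 - 1 > 0 shows this. The
    hypothesis \<open>card S > 1\<close> is supplied later by k \<ge> 2.\<close>
  have "poly R 1 = int (card S) * int (card S) - 1"
    by (simp add: R_def poly_reflect_poly_1 poly_set_poly_1 poly_monom)
  moreover have "1 * 1 < int (card S) * int (card S)"
    using S(3) by (intro mult_strict_mono) auto
  ultimately have R0: "R \<noteq> 0"
    by auto
  have degR: "degree R \<le> 2 * N"
  proof -
    have "degree (set_poly S) \<le> N"
      using \<open>Max S \<le> N\<close> S(1) \<open>S \<noteq> {}\<close> by (simp add: degree_set_poly)
    then have "degree (set_poly S * reflect_poly (set_poly S)) \<le> 2 * N"
      using degree_mult_le[of "set_poly S" "reflect_poly (set_poly S)"] degree_reflect_poly_le[of "set_poly S"]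
      by linarith
    then show ?thesis
      unfolding R_def using \<open>Max S \<le> N\<close> degree_monom_le[of "1 :: int" "Max S"]
      by (intro degree_diff_le) (auto intro: order_trans)
  qed
  have prime: "prime (q n)" "lead_coeff (q n) = 1" if "n \<in> X" for n
    using q(1)[OF that] by (auto simp: is_noncyclotomic_factor_def)
  have "finite (prime_factors R)"
    by simp
  moreover have "q ` X \<subseteq> prime_factors R"
    using dvdR prime(1) R0 by (auto simp: in_prime_factors_iff)
  ultimately have "finite (q ` X)"
    by (rule finite_subset[rotated])
  then have finX: "finite X"
    using inj by (rule finite_imageD)
  define X1 where "X1 = {n \<in> X. degree (q n) \<ge> D}"
  define X2 where "X2 = {n \<in> X. degree (q n) < D}"
  have X: "X = X1 \<union> X2"
    by (auto simp: X1_def X2_def)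
  have fin12: "finite X1" "finite X2"
    using finX by (auto simp: X1_def X2_def)
  have inj1: "inj_on q X1" and inj2: "inj_on q X2"
    using inj by (auto simp: X1_def X2_def intro: inj_on_subset)
  have "card X1 * D = (\<Sum>n\<in>X1. D)"
    by simp
  also have "\<dots> \<le> (\<Sum>n\<in>X1. degree (q n))"
    by (intro sum_mono) (auto simp: X1_def)
  also have "\<dots> = (\<Sum>p\<in>q ` X1. degree p)"
    by (simp add: sum.reindex[OF inj1])
  also have "\<dots> \<le> degree R"
    using fin12 R0 dvdR prime by (intro sum_degree_primes_le) (auto simp: X1_def)
  also note degR
  finally have "real (card X1) * real D \<le> 2 * real N"
    by (metis of_nat_le_iff of_nat_mult of_nat_numeral)
  then have c1: "real (card X1) \<le> 2 * real N / real D"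
    using D by (simp add: field_simps)
  have "q ` X2 \<subseteq> K"
  proof
    fix p assume "p \<in> q ` X2"
    then obtain n where n: "n \<in> X" "p = q n" "degree p < D"
      by (auto simp: X2_def)
    have "cmod z \<le> 2" if z: "poly (cpoly p) z = 0" for z
    proof -
      have "poly (cpoly (set_poly (insert n S))) z = 0"
        using q(1)[OF n(1)] cpoly_root_dvd[OF _ z] n(2) by (simp add: is_noncyclotomic_factor_def)
      then show ?thesis
        using cmod_root_set_poly_less[of "insert n S" z] S(1) by simp
    qed
    with n prime show "p \<in> K"
      by (auto simp: K_def)
  qed
  then have c2: "card X2 \<le> card K"
    using card_mono[OF finK] by (metis card_image inj2)
  have "card X \<le> card X1 + card X2"
    unfolding X by (rule card_Un_le)
  with c1 c2 show "real (card (common_factor_exponents S)) \<le> 2 * real N / real D + real (card K)"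
    unfolding X_def[symmetric] by linarith
  show "finite (common_factor_exponents S)"
    using finX by (simp add: X_def)
qed

section \<open>Tuples with coinciding triple sums\<close>

text \<open>The relation recovers the entry with nonzero coefficient from the others, so deleting
  that entry is injective.\<close>

lemma card_lists_linear_relation:
  fixes c :: "nat \<Rightarrow> int"
  assumes j: "j < k" "c j \<noteq> 0" and A: "finite A"
  shows "card {ns. length ns = k \<and> set ns \<subseteq> A \<and> (\<Sum>i<k. c i * int (ns ! i)) = 0} \<le> card A ^ (k - 1)"
    (is "card ?L \<le> _")
proof -
  define del where "del = (\<lambda>ns :: nat list. take j ns @ drop (Suc j) ns)"
  have "inj_on del ?L"
  proof (rule inj_onI)
    fix ns ms assume nsms: "ns \<in> ?L" "ms \<in> ?L" "del ns = del ms"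
    then have td: "take j ns = take j ms" "drop (Suc j) ns = drop (Suc j) ms"
      using j(1) by (auto simp: del_def)
    have nth: "ns ! i = ms ! i" if "i < k" "i \<noteq> j" for i
    proof (cases "i < j")
      case True
      then show ?thesis
        using td(1) by (metis nth_take)
    next
      case False
      then have "Suc j + (i - Suc j) = i"
        using that by simp
      then show ?thesis
        using nth_drop[of "Suc j" ns "i - Suc j"] nth_drop[of "Suc j" ms "i - Suc j"] td(2) nsms(1,2) j(1)
        by simp
    qed
    have "c j * int (ns ! j) + (\<Sum>i\<in>{..<k} - {j}. c i * int (ns ! i)) = 0"
        "c j * int (ms ! j) + (\<Sum>i\<in>{..<k} - {j}. c i * int (ms ! i)) = 0"
      using nsms(1,2) j(1) sum.remove[of "{..<k}" j "\<lambda>i. c i * int (ns ! i)"]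
        sum.remove[of "{..<k}" j "\<lambda>i. c i * int (ms ! i)"] by simp_all
    moreover have "(\<Sum>i\<in>{..<k} - {j}. c i * int (ns ! i)) = (\<Sum>i\<in>{..<k} - {j}. c i * int (ms ! i))"
      by (intro sum.cong) (auto simp: nth)
    ultimately have "c j * int (ns ! j) = c j * int (ms ! j)"
      by linarith
    with j(2) have "ns ! j = ms ! j"
      by simp
    with nth nsms(1,2) show "ns = ms"
      by (intro nth_equalityI) auto
  qed
  moreover have "del ` ?L \<subseteq> {ns. set ns \<subseteq> A \<and> length ns = k - 1}"
    using j(1) by (force simp: del_def dest!: in_set_takeD in_set_dropD)
  ultimately have "card ?L \<le> card {ns. set ns \<subseteq> A \<and> length ns = k - 1}"
    using A by (intro card_inj_on_le) (auto intro: finite_lists_length_eq)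
  then show ?thesis
    using A by (simp add: card_lists_length_eq)
qed

text \<open>The coefficient \<open>c i\<close> is the multiplicity of the i-th entry in the first
  triple minus that in the second, hence lies between -3 and 3.\<close>

lemma linear_relation_of_not_unique_triple_sums:
  assumes ns: "distinct ns" "0 \<notin> set ns" "\<not> unique_triple_sums (insert 0 (set ns))"
  obtains c j where "c \<in> {..<length ns} \<rightarrow>\<^sub>E {-3..3::int}" "j < length ns" "c j \<noteq> 0"
    "(\<Sum>i<length ns. c i * int (ns ! i)) = 0"
proof -
  define k where "k = length ns"
  obtain x y z u v w where xyz: "x \<in> insert 0 (set ns)" "y \<in> insert 0 (set ns)" "z \<in> insert 0 (set ns)"
      and uvw: "u \<in> insert 0 (set ns)" "v \<in> insert 0 (set ns)" "w \<in> insert 0 (set ns)"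
      and eq: "x + y + z = u + v + w" and ne: "{#x, y, z#} \<noteq> {#u, v, w#}"
    using ns(3) unfolding unique_triple_sums_def by blast
  define \<delta> :: "nat \<Rightarrow> nat \<Rightarrow> int" where "\<delta> a i = of_bool (ns ! i = a)" for a i
  have \<delta>: "(\<Sum>i<k. \<delta> a i * int (ns ! i)) = int a" if a: "a \<in> insert 0 (set ns)" for a
  proof (cases "a = 0")
    case False
    with a obtain l where l: "l < k" "a = ns ! l"
      by (auto simp: in_set_conv_nth k_def)
    then have "\<delta> a i * int (ns ! i) = (if i = l then int a else 0)" if "i < k" for i
      using that ns(1) by (simp add: \<delta>_def nth_eq_iff_index_eq k_def)
    with l show ?thesis
      by simp
  qed (simp add: \<delta>_def)
  define c where "c = (\<lambda>i\<in>{..<k}. \<delta> x i + \<delta> y i + \<delta> z i - \<delta> u i - \<delta> v i - \<delta> w i)"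
  have "(\<Sum>i<k. c i * int (ns ! i)) = 0"
    using eq xyz uvw by (simp add: c_def algebra_simps sum.distrib sum_subtractf \<delta>)
  moreover have "c \<in> {..<k} \<rightarrow>\<^sub>E {-3..3}"
  proof (rule PiE_I)
    fix i assume "i \<in> {..<k}"
    moreover have "0 \<le> \<delta> a i \<and> \<delta> a i \<le> 1" for a
      by (simp add: \<delta>_def)
    from this[of x] this[of y] this[of z] this[of u] this[of v] this[of w]
    have "-3 \<le> \<delta> x i + \<delta> y i + \<delta> z i - \<delta> u i - \<delta> v i - \<delta> w i"
        "\<delta> x i + \<delta> y i + \<delta> z i - \<delta> u i - \<delta> v i - \<delta> w i \<le> 3"
      by linarith+
    ultimately show "c i \<in> {-3..3}"
      by (simp add: c_def)
  qed (simp add: c_def)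
  moreover have "\<exists>j<k. c j \<noteq> 0"
  proof (rule ccontr)
    assume "\<not> ?thesis"
    then have c0: "c j = 0" if "j < k" for j
      using that by blast
    have count: "count {#x, y, z#} a = count {#u, v, w#} a" if a: "a \<in> set ns" for a
    proof -
      obtain l where l: "l < k" "a = ns ! l"
        using a by (auto simp: in_set_conv_nth k_def)
      then have "int (count {#x, y, z#} a) - int (count {#u, v, w#} a) = c l"
        by (simp add: c_def \<delta>_def eq_commute[of "ns ! l"])
      with c0[OF l(1)] show ?thesis
        by simp
    qed
    \<comment> \<open>The element 0 carries no coefficient; its multiplicity is recovered from the
      common size 3 of the two triples.\<close>
    have *: "count M 0 = size M - (\<Sum>a\<in>set ns. count M a)" if "set_mset M \<subseteq> insert 0 (set ns)" for M
    proof -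
      have "size M = (\<Sum>a\<in>insert 0 (set ns). count M a)"
        unfolding size_multiset_overloaded_eq
        using that by (intro sum.mono_neutral_left) (auto simp: not_in_iff)
      then show ?thesis
        using ns(2) by simp
    qed
    have "{#x, y, z#} = {#u, v, w#}"
    proof (rule multiset_eqI)
      fix a
      consider "a \<in> set ns" | "a = 0" | "a \<notin> insert 0 (set ns)"
        by blast
      then show "count {#x, y, z#} a = count {#u, v, w#} a"
      proof cases
        case 2
        have "(\<Sum>a\<in>set ns. count {#x, y, z#} a) = (\<Sum>a\<in>set ns. count {#u, v, w#} a)"
          by (intro sum.cong refl count)
        then show ?thesis
          using xyz uvw 2 *[of "{#x, y, z#}"] *[of "{#u, v, w#}"] by simp
      next
        case 3
        then show ?thesis
          using xyz uvw by auto
      qed (rule count)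
    qed
    with ne show False
      by simp
  qed
  ultimately show ?thesis
    using that by (auto simp: k_def)
qed

text \<open>A union bound over the possible relations: each of the k coefficients takes one of the 7
  values from -3 to 3.\<close>

lemma card_not_unique_triple_sums:
  "card {ns. length ns = k \<and> set ns \<subseteq> {1..N} \<and> distinct ns \<and> \<not> unique_triple_sums (insert 0 (set ns))}
     \<le> 7 ^ k * N ^ (k - 1)" (is "card ?L \<le> _")
proof -
  define C where "C = {c \<in> {..<k} \<rightarrow>\<^sub>E {-3..3::int}. \<exists>j<k. c j \<noteq> 0}"
  define L where "L c = {ns. length ns = k \<and> set ns \<subseteq> {1..N} \<and> (\<Sum>i<k. c i * int (ns ! i)) = 0}" for c
  have finPiE: "finite ({..<k} \<rightarrow>\<^sub>E {-3..3::int})"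
    by (intro finite_PiE) auto
  then have finC: "finite C"
    by (simp add: C_def)
  have finL: "finite (L c)" for c
    by (rule finite_subset[OF _ finite_lists_length_eq[of "{1..N}" k]]) (auto simp: L_def)
  have "?L \<subseteq> (\<Union>c\<in>C. L c)"
  proof
    fix ns assume ns: "ns \<in> ?L"
    then have "0 \<notin> set ns"
      by auto
    with ns obtain c j where "c \<in> {..<k} \<rightarrow>\<^sub>E {-3..3::int}" "j < k" "c j \<noteq> 0"
        "(\<Sum>i<k. c i * int (ns ! i)) = 0"
      using linear_relation_of_not_unique_triple_sums[of ns] by auto
    with ns show "ns \<in> (\<Union>c\<in>C. L c)"
      by (auto simp: C_def L_def)
  qed
  then have "card ?L \<le> card (\<Union>c\<in>C. L c)"
    using finC finL by (intro card_mono) auto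
  also have "\<dots> \<le> (\<Sum>c\<in>C. card (L c))"
    by (rule card_UN_le[OF finC])
  also have "\<dots> \<le> (\<Sum>c\<in>C. N ^ (k - 1))"
    using card_lists_linear_relation[of _ k _ "{1..N}"] by (intro sum_mono) (auto simp: C_def L_def)
  also have "\<dots> = card C * N ^ (k - 1)"
    by simp
  also have "card C \<le> card ({..<k} \<rightarrow>\<^sub>E {-3..3::int})"
    using finPiE by (intro card_mono) (auto simp: C_def)
  also have "\<dots> = 7 ^ k"
    by (simp add: card_PiE)
  finally show ?thesis
    by simp
qed

section \<open>The final estimate\<close>

lemma F_poly_eq_set_poly:
  assumes "distinct ns" "0 \<notin> set ns"
  shows "F_poly ns = set_poly (insert 0 (set ns))"
proof -
  have "(\<Sum>i<length ns. monom 1 (ns ! i)) = (\<Sum>n\<in>set ns. monom (1 :: int) n)"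
    by (rule sum.reindex_bij_betw) (rule bij_betw_nth[OF assms(1)], auto)
  with assms(2) show ?thesis
    by (simp add: F_poly_def set_poly_def monom_0 one_pCons)
qed

text \<open>The summand 7^k accounts for coinciding triple sums. The other two bound the last
  exponents above each of at most N^(k-1) prefixes; \<open>K\<close> is independent of the prefix
  and of N.\<close>

lemma card_E_le:
  assumes k: "k \<ge> 2" and D: "D > 0"
  defines "K \<equiv> {q :: int poly. degree q < D \<and> lead_coeff q = 1 \<and> (\<forall>z. poly (cpoly q) z = 0 \<longrightarrow> cmod z \<le> 2)}"
  shows "real (E k N) \<le> real N ^ (k - 1) * (7 ^ k + 2 * real N / real D + real (card K))"
proof -
  define A where "A = {ns. length ns = k \<and> set ns \<subseteq> {1..N} \<and> distinct ns \<and>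
      \<not> unique_triple_sums (insert 0 (set ns))}"
  define Pre where "Pre = {ms. length ms = k - 1 \<and> sorted_wrt (<) ms \<and> set ms \<subseteq> {1..N}}"
  define Y where "Y = (\<lambda>ms. common_factor_exponents (insert 0 (set ms)))"
  define B where "B = (\<Union>ms\<in>Pre. (\<lambda>n. ms @ [n]) ` Y ms)"
  define Es where "Es = {ns :: nat list. length ns = k \<and> sorted_wrt (<) ns \<and> set ns \<subseteq> {1..N} \<and>
       reducible_poly (map_poly (of_int :: int \<Rightarrow> rat) (noncyclotomic_part (F_poly ns)))}"
  have Pre_sub: "Pre \<subseteq> {ms. set ms \<subseteq> {1..N} \<and> length ms = k - 1}"
    by (auto simp: Pre_def)
  then have finPre: "finite Pre"
    by (rule finite_subset) (simp add: finite_lists_length_eq)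
  have Pre: "finite (insert 0 (set ms))" "0 \<in> insert 0 (set ms)" "card (insert 0 (set ms)) > 1"
      "insert 0 (set ms) \<subseteq> {..N}" if "ms \<in> Pre" for ms
  proof -
    have "distinct ms" "0 \<notin> set ms" "length ms = k - 1"
      using that by (auto simp: Pre_def strict_sorted_iff)
    with k show "card (insert 0 (set ms)) > 1"
      by (simp add: distinct_card)
  qed (use that in \<open>auto simp: Pre_def\<close>)
  have finY: "finite (Y ms)"
    and cardY: "real (card (Y ms)) \<le> 2 * real N / real D + real (card K)" if "ms \<in> Pre" for ms
    unfolding Y_def K_def using card_common_factor_exponents[OF Pre[OF that] D] by auto
  have finB: "finite B"
    using finPre finY by (auto simp: B_def)
  have finA: "finite A"
    by (rule finite_subset[OF _ finite_lists_length_eq[of "{1..N}" k]]) (auto simp: A_def)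
  have "Es \<subseteq> A \<union> B"
  proof
    fix ns assume ns: "ns \<in> Es"
    have dist: "distinct ns" and zero: "0 \<notin> set ns"
      using ns by (auto simp: Es_def strict_sorted_iff)
    define S where "S = insert 0 (set ns)"
    have "card S = k + 1"
      using dist zero ns by (simp add: S_def distinct_card Es_def)
    show "ns \<in> A \<union> B"
    proof (cases "unique_triple_sums S")
      case False
      with ns dist show ?thesis
        by (auto simp: A_def Es_def S_def)
    next
      case True
      have "reducible_poly (map_poly (of_int :: int \<Rightarrow> rat) (noncyclotomic_part (set_poly S)))"
        using ns F_poly_eq_set_poly[OF dist zero] by (simp add: Es_def S_def)
      then obtain q where q: "is_noncyclotomic_factor q (set_poly S)" "q dvd reflect_poly (set_poly S)"
        using common_factor_of_reducible[of S] True \<open>card S = k + 1\<close> k by (auto simp: S_def)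
      have "ns \<noteq> []"
        using ns k by (auto simp: Es_def)
      then obtain ms n where msn: "ns = ms @ [n]"
        by (metis append_butlast_last_id)
      have "ms \<in> Pre"
        using ns by (auto simp: Pre_def Es_def msn sorted_wrt_append)
      moreover have "n > Max (insert 0 (set ms))"
        using ns by (subst Max_less_iff) (auto simp: Es_def msn sorted_wrt_append)
      moreover have "S = insert n (insert 0 (set ms))"
        by (auto simp: S_def msn)
      ultimately show ?thesis
        using q by (auto simp: B_def Y_def common_factor_exponents_def msn)
    qed
  qed
  then have "card Es \<le> card (A \<union> B)"
    using finA finB by (intro card_mono) auto
  also have "\<dots> \<le> card A + card B"
    by (rule card_Un_le)
  finally have 1: "real (E k N) \<le> real (card A) + real (card B)"
    by (simp add: E_def Es_def)
  have 2: "real (card A) \<le> 7 ^ k * real N ^ (k - 1)"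
    using card_not_unique_triple_sums[of k N] unfolding A_def
    by (metis (no_types, lifting) of_nat_le_iff of_nat_mult of_nat_power of_nat_numeral)
  have cB: "card B \<le> (\<Sum>ms\<in>Pre. card (Y ms))"
    unfolding B_def using finY
    by (intro order_trans[OF card_UN_le[OF finPre]] sum_mono card_image_le)
  have cPre: "card Pre \<le> N ^ (k - 1)"
    using card_mono[OF _ Pre_sub] by (simp add: finite_lists_length_eq card_lists_length_eq)
  have "real (card B) \<le> (\<Sum>ms\<in>Pre. real (card (Y ms)))"
    using cB by (metis of_nat_le_iff of_nat_sum)
  also have "\<dots> \<le> (\<Sum>ms\<in>Pre. 2 * real N / real D + real (card K))"
    by (intro sum_mono cardY)
  also have "\<dots> = real (card Pre) * (2 * real N / real D + real (card K))"
    by simp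
  also have "\<dots> \<le> real (N ^ (k - 1)) * (2 * real N / real D + real (card K))"
    using cPre by (intro mult_right_mono) (auto simp del: of_nat_power)
  finally show ?thesis
    using 1 2 by (simp add: algebra_simps)
qed

theorem theorem2:
  fixes k :: nat
  assumes "k \<ge> 2"
  shows "(\<lambda>N. real (E k N)) \<in> o(\<lambda>N. real N ^ k)"
proof (rule landau_o.smallI)
  fix c :: real
  assume c: "c > 0"
  \<comment> \<open>With D \<ge> 4/c the term 2N/D is at most cN/2; the remaining constant
    \<open>b\<close> is at most cN/2 once N \<ge> 2b/c.\<close>
  define D where "D = nat \<lceil>4 / c\<rceil>"
  have D: "real D \<ge> 4 / c"
    unfolding D_def by linarith
  moreover have "4 / c > 0"
    using c by simp
  ultimately have "real D > 0" by linarith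
  then have D0: "D > 0" by simp
  define K where "K = {q :: int poly. degree q < D \<and> lead_coeff q = 1 \<and> (\<forall>z. poly (cpoly q) z = 0 \<longrightarrow> cmod z \<le> 2)}"
  define b where "b = 7 ^ k + real (card K)"
  have "eventually (\<lambda>N. real N \<ge> 2 * b / c) sequentially"
    by (rule eventually_sequentiallyI[of "nat \<lceil>2 * b / c\<rceil>"]) linarith
  then show "eventually (\<lambda>N. norm (real (E k N)) \<le> c * norm (real N ^ k)) sequentially"
  proof eventually_elim
    case (elim N)
    then have "b \<le> c / 2 * real N"
      using c by (simp add: field_simps)
    moreover have "2 / real D \<le> c / 2"
      using D c \<open>real D > 0\<close> by (simp add: field_simps)
    then have "2 / real D * real N \<le> c / 2 * real N"
      by (rule mult_right_mono) simp
    ultimately have "7 ^ k + 2 * real N / real D + real (card K) \<le> c * real N"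
      by (simp add: b_def)
    then have "real N ^ (k - 1) * (7 ^ k + 2 * real N / real D + real (card K)) \<le> real N ^ (k - 1) * (c * real N)"
      by (rule mult_left_mono) simp
    with card_E_le[OF assms D0, of N] have "real (E k N) \<le> c * (real N ^ (k - 1) * real N)"
      unfolding K_def by (simp add: mult_ac)
    also have "real N ^ (k - 1) * real N = real N ^ k"
      using assms by (metis One_nat_def Suc_pred not_numeral_le_zero power_Suc2 gr0I)
    finally show ?case
      by simp
  qed
qed

end
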